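(* Let $\nu>0$. Then the discrete variational problem $$\inf_{(m,w)\in\mathcal{M}\times\mathcal{W}} \ \mathcal{B}(m,w)+\mathcal{F}(m)\quad\text{subject to}\quad \mathcal{G}(m,w)=(0,\bar m)$$ admits at least one solution $(m,w)\in\mathcal{M}\times\mathcal{W}$, and associated to it there exists $u=(u^k_{i,j})_{0\le k\le N_T,\,0\le i,j\le N_h-1}\in\mathbb{R}^{(N_T+1)\times N_h\times N_h}$ such that $(u,m)$ satisfies the discrete mean field game system: for all $0\le i,j\le N_h-1$ and $0\le k\le N_T-1$, $$\begin{cases} -D_t u^k_{i,j}-\nu(\Delta_h u^k)_{i,j}+\frac{1}{q'}\big|\widehat{[D_hu^k]}_{i,j}\big|^{q'}=f(x_{i,j},m^{k+1}_{i,j}),\\[4pt] D_t m^k_{i,j}-\nu(\Delta_h m^{k+1})_{i,j}-\mathcal{T}_{i,j}(u^k,m^{k+1})=0,\\[4pt] m^0_{i,j}=\bar m_{i,j},\qquad u^{N_T}_{i,j}=g(x_{i,j},m^{N_T}_{i,j}).\end{cases}$$ Moreover, $m^k_{i,j}>0$ for all $k=1,\dots,N_T$ and all $i,j=0,\dots,N_h-1$.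
   Context: Data. $q>1$, $q'=q/(q-1)$, $T>0$; $\mathbb{T}^2$ is the two-dimensional torus; $f,g:\mathbb{T}^2\times\mathbb{R}\to\mathbb{R}$ are continuous; $m_0\in L^1(\mathbb{T}^2)$, $m_0\ge 0$, $\int_{\mathbb{T}^2}m_0\,dx=1$. $|\cdot|$ is the Euclidean norm. (The Hamiltonian is $H(x,p)=\frac1{q'}|p|^{q'}$.) Grid. $N_T,N_h$ are positive integers, $\Delta t=T/N_T$, $h=1/N_h$, $x_{i,j}=(ih,jh)$. Spatial indices $i,j$ are taken modulo $N_h$ (periodicity), so $i,j\in\{0,\dots,N_h-1\}$. Put $\bar m_{i,j}:=\frac{1}{h^2}\int_{|x-x_{i,j}|_\infty\le h/2}m_0(x)\,dx\ge 0$. Finite differences. For $y=(y_{i,j})$: $(D_1y)_{i,j}=\frac{y_{i+1,j}-y_{i,j}}{h}$, $(D_2y)_{i,j}=\frac{y_{i,j+1}-y_{i,j}}{h}$, $(\Delta_h y)_{i,j}=-\frac1{h^2}(4y_{i,j}-y_{i+1,j}-y_{i-1,j}-y_{i,j+1}-y_{i,j-1})$. For $a\in\mathbb{R}$, $a^+=\max(a,0)$, $a^-=a^+-a$. Set $$\widehat{[D_hy]}_{i,j}=\big((D_1y)^-_{i,j},\,-(D_1y)^+_{i-1,j},\,(D_2y)^-_{i,j},\,-(D_2y)^+_{i,j-1}\big)\in\mathbb{R}^4.$$ For a time-dependent $y$, $D_ty^k=\frac{y^{k+1}-y^k}{\Delta t}$. Transport operator. For $u'=(u'_{i,j})$, $m'=(m'_{i,j})$,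 write $c_{i,j}=\big|\widehat{[D_hu']}_{i,j}\big|^{\frac{2-q}{q-1}}$, with the convention that $c_{i,j}\widehat{[D_hu']}_{i,j}=0$ (componentwise) whenever $\widehat{[D_hu']}_{i,j}=0$. Then $$\begin{aligned}\mathcal{T}_{i,j}(u',m')=\frac1h\Big(&-m'_{i,j}c_{i,j}(D_1u')^-_{i,j}+m'_{i-1,j}c_{i-1,j}(D_1u')^-_{i-1,j}+m'_{i+1,j}c_{i+1,j}(D_1u')^+_{i,j}-m'_{i,j}c_{i,j}(D_1u')^+_{i-1,j}\\&-m'_{i,j}c_{i,j}(D_2u')^-_{i,j}+m'_{i,j-1}c_{i,j-1}(D_2u')^-_{i,j-1}+m'_{i,j+1}c_{i,j+1}(D_2u')^+_{i,j}-m'_{i,j}c_{i,j}(D_2u')^+_{i,j-1}\Big).\end{aligned}$$ Variational problem. $K=\mathbb{R}_+\times\mathbb{R}_-\times\mathbb{R}_+\times\mathbb{R}_-$, where $\mathbb{R}_+=[0,\infty)$, $\mathbb{R}_-=(-\infty,0]$. $\mathcal{M}=\mathbb{R}^{(N_T+1)\times N_h\times N_h}$ (elements $m^k_{i,j}$, $0\le k\le N_T$), $\mathcal{W}=(\mathbb{R}^4)^{N_T\times N_h\times N_h}$ (elements $w^k_{i,j}=(w^{k,(1)}_{i,j},\dots,w^{k,(4)}_{i,j})$, $0\le k\le N_T-1$), $\mathcal{U}=\mathbb{R}^{N_T\times N_h\times N_h}$. The linear operators $A:\mathcal{M}\to\mathcal{U}$, $B:\mathcal{W}\to\mathcal{U}$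 are, for $0\le k\le N_T-1$, $$(Am)^k_{i,j}=D_tm^k_{i,j}-\nu(\Delta_hm^{k+1})_{i,j},\qquad (Bw)^k_{i,j}=(D_1w^{k,(1)})_{i-1,j}+(D_1w^{k,(2)})_{i,j}+(D_2w^{k,(3)})_{i,j-1}+(D_2w^{k,(4)})_{i,j}.$$ $\widehat b:\mathbb{R}\times\mathbb{R}^4\to\mathbb{R}\cup\{+\infty\}$ is $\widehat b(m,w)=\frac{|w|^q}{q\,m^{q-1}}$ if $m>0$ and $w\in K$; $\widehat b(0,0)=0$; $\widehat b(m,w)=+\infty$ otherwise. $F(x,m)=\int_0^mf(x,s)\,ds$ and $G(x,m)=\int_0^mg(x,s)\,ds$ if $m\ge0$, both equal to $+\infty$ if $m<0$. Finally $$\mathcal{B}(m,w)=\sum_{k=1}^{N_T}\sum_{i,j=0}^{N_h-1}\widehat b(m^k_{i,j},w^{k-1}_{i,j}),\quad \mathcal{F}(m)=\sum_{k=1}^{N_T}\sum_{i,j=0}^{N_h-1}F(x_{i,j},m^k_{i,j})+\frac1{\Delta t}\sum_{i,j=0}^{N_h-1}G(x_{i,j},m^{N_T}_{i,j}),$$ $$\mathcal{G}(m,w)=(Am+Bw,\,m^0)\in\mathcal{U}\times\mathbb{R}^{N_h\times N_h}.$$ A solution of the problem is a feasible pair attaining the (finite) infimum. *)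

theory Defs
  imports "HOL-Analysis.Analysis"
begin

text \<open>
  Functions on the two-dimensional torus are functions on the plane that are 1-periodic in
  each variable. Grid functions are functions of a pair of integers that are periodic with
  period \<open>N\<close> in each index, so that spatial indices are automatically read modulo \<open>N\<close>. Throughout,
  \<open>N\<close> is the number of grid points per direction (mesh size \<open>1 / N\<close>), \<open>NT\<close> the number of time
  steps and \<open>T / NT\<close> the length of one step.
\<close>

definition torus_periodic :: "(real \<times> real \<Rightarrow> 'a) \<Rightarrow> bool" where
  "torus_periodic \<phi> \<longleftrightarrow> (\<forall>x y. \<phi> (x + 1, y) = \<phi> (x, y) \<and> \<phi> (x, y + 1) = \<phi> (x, y))"

definition gridfun :: "nat \<Rightarrow> (int \<Rightarrow> int \<Rightarrow> 'a) set" where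
  "gridfun N = {y. \<forall>i j. y (i + int N) j = y i j \<and> y i (j + int N) = y i j}"

text \<open>The extensional function sets make time-dependent grid functions determined by their
  values at the admissible time indices; they are copies of
  \<open>\<real>\<close> to the power \<open>(NT + 1) \<times> N \<times> N\<close> and of \<open>\<real>\<^sup>4\<close> to the power \<open>NT \<times> N \<times> N\<close>.\<close>

definition spaceM :: "nat \<Rightarrow> nat \<Rightarrow> (nat \<Rightarrow> int \<Rightarrow> int \<Rightarrow> real) set" where
  "spaceM NT N = {0..NT} \<rightarrow>\<^sub>E gridfun N"

definition spaceW :: "nat \<Rightarrow> nat \<Rightarrow> (nat \<Rightarrow> int \<Rightarrow> int \<Rightarrow> real ^ 4) set" where
  "spaceW NT N = {0..<NT} \<rightarrow>\<^sub>E gridfun N"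

definition mesh :: "nat \<Rightarrow> real" where
  "mesh N = 1 / real N"

definition tstep :: "real \<Rightarrow> nat \<Rightarrow> real" where
  "tstep T NT = T / real NT"

definition gridpt :: "nat \<Rightarrow> int \<Rightarrow> int \<Rightarrow> real \<times> real" where
  "gridpt N i j = (of_int i * mesh N, of_int j * mesh N)"

text \<open>The box is the closed ball of radius \<open>h / 2\<close> around the grid point for the maximum norm.\<close>

definition mbar :: "nat \<Rightarrow> (real \<times> real \<Rightarrow> real) \<Rightarrow> int \<Rightarrow> int \<Rightarrow> real" where
  "mbar N m0 i j =
     (1 / (mesh N)\<^sup>2) *
     integral (cbox (gridpt N i j - (mesh N / 2, mesh N / 2))
                    (gridpt N i j + (mesh N / 2, mesh N / 2))) m0"

subsection \<open>Finite differences\<close>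

definition pospart :: "real \<Rightarrow> real" where
  "pospart a = max a 0"

definition negpart :: "real \<Rightarrow> real" where
  "negpart a = pospart a - a"

definition D1 :: "nat \<Rightarrow> (int \<Rightarrow> int \<Rightarrow> real) \<Rightarrow> int \<Rightarrow> int \<Rightarrow> real" where
  "D1 N y i j = (y (i + 1) j - y i j) / mesh N"

definition D2 :: "nat \<Rightarrow> (int \<Rightarrow> int \<Rightarrow> real) \<Rightarrow> int \<Rightarrow> int \<Rightarrow> real" where
  "D2 N y i j = (y i (j + 1) - y i j) / mesh N"

definition Lap :: "nat \<Rightarrow> (int \<Rightarrow> int \<Rightarrow> real) \<Rightarrow> int \<Rightarrow> int \<Rightarrow> real" where
  "Lap N y i j =
     - (1 / (mesh N)\<^sup>2) * (4 * y i j - y (i + 1) j - y (i - 1) j - y i (j + 1) - y i (j - 1))"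

definition hatD :: "nat \<Rightarrow> (int \<Rightarrow> int \<Rightarrow> real) \<Rightarrow> int \<Rightarrow> int \<Rightarrow> real ^ 4" where
  "hatD N y i j =
     vector [negpart (D1 N y i j), - pospart (D1 N y (i - 1) j),
             negpart (D2 N y i j), - pospart (D2 N y i (j - 1))]"

definition Dt :: "real \<Rightarrow> nat \<Rightarrow> (nat \<Rightarrow> int \<Rightarrow> int \<Rightarrow> real) \<Rightarrow> nat \<Rightarrow> int \<Rightarrow> int \<Rightarrow> real" where
  "Dt T NT y k i j = (y (k + 1) i j - y k i j) / tstep T NT"

text \<open>Since \<open>0 powr a = 0\<close>, this factor vanishes where \<open>hatD\<close> does. Every term of \<open>transport\<close>
  below is the density times a component of \<open>hatD\<close> times the factor at the same grid point,
  so that this is the usual convention that the product vanishes there.\<close>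

definition coef :: "real \<Rightarrow> nat \<Rightarrow> (int \<Rightarrow> int \<Rightarrow> real) \<Rightarrow> int \<Rightarrow> int \<Rightarrow> real" where
  "coef q N u i j = norm (hatD N u i j) powr ((2 - q) / (q - 1))"

definition transport ::
  "real \<Rightarrow> nat \<Rightarrow> (int \<Rightarrow> int \<Rightarrow> real) \<Rightarrow> (int \<Rightarrow> int \<Rightarrow> real) \<Rightarrow> int \<Rightarrow> int \<Rightarrow> real" where
  "transport q N u m i j =
     (1 / mesh N) *
     ( - m i j * coef q N u i j * negpart (D1 N u i j)
       + m (i - 1) j * coef q N u (i - 1) j * negpart (D1 N u (i - 1) j)
       + m (i + 1) j * coef q N u (i + 1) j * pospart (D1 N u i j)
       - m i j * coef q N u i j * pospart (D1 N u (i - 1) j)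
       - m i j * coef q N u i j * negpart (D2 N u i j)
       + m i (j - 1) * coef q N u i (j - 1) * negpart (D2 N u i (j - 1))
       + m i (j + 1) * coef q N u i (j + 1) * pospart (D2 N u i j)
       - m i j * coef q N u i j * pospart (D2 N u i (j - 1)))"

subsection \<open>The discrete variational problem\<close>

definition coneK :: "(real ^ 4) set" where
  "coneK = {w. w $ 1 \<ge> 0 \<and> w $ 2 \<le> 0 \<and> w $ 3 \<ge> 0 \<and> w $ 4 \<le> 0}"

definition opA ::
  "real \<Rightarrow> real \<Rightarrow> nat \<Rightarrow> nat \<Rightarrow> (nat \<Rightarrow> int \<Rightarrow> int \<Rightarrow> real) \<Rightarrow> nat \<Rightarrow> int \<Rightarrow> int \<Rightarrow> real" where
  "opA \<nu> T NT N m k i j = Dt T NT m k i j - \<nu> * Lap N (m (k + 1)) i j"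

definition opB :: "nat \<Rightarrow> (nat \<Rightarrow> int \<Rightarrow> int \<Rightarrow> real ^ 4) \<Rightarrow> nat \<Rightarrow> int \<Rightarrow> int \<Rightarrow> real" where
  "opB N w k i j =
     D1 N (\<lambda>i j. w k i j $ 1) (i - 1) j + D1 N (\<lambda>i j. w k i j $ 2) i j
     + D2 N (\<lambda>i j. w k i j $ 3) i (j - 1) + D2 N (\<lambda>i j. w k i j $ 4) i j"

definition bhat :: "real \<Rightarrow> real \<Rightarrow> real ^ 4 \<Rightarrow> ereal" where
  "bhat q m w =
     (if m > 0 \<and> w \<in> coneK then ereal (norm w powr q / (q * m powr (q - 1)))
      else if m = 0 \<and> w = 0 then 0
      else \<infinity>)"

text \<open>Used for both \<open>F\<close> (from \<open>f\<close>) and \<open>G\<close> (from \<open>g\<close>).\<close>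

definition primitive :: "(real \<times> real \<Rightarrow> real \<Rightarrow> real) \<Rightarrow> real \<times> real \<Rightarrow> real \<Rightarrow> ereal" where
  "primitive f x m = (if m \<ge> 0 then ereal (integral {0..m} (f x)) else \<infinity>)"

definition costB ::
  "real \<Rightarrow> nat \<Rightarrow> nat \<Rightarrow> (nat \<Rightarrow> int \<Rightarrow> int \<Rightarrow> real) \<Rightarrow> (nat \<Rightarrow> int \<Rightarrow> int \<Rightarrow> real ^ 4) \<Rightarrow> ereal" where
  "costB q NT N m w =
     (\<Sum>k = 1..NT. \<Sum>i = 0..<int N. \<Sum>j = 0..<int N. bhat q (m k i j) (w (k - 1) i j))"

definition costF ::
  "real \<Rightarrow> nat \<Rightarrow> nat \<Rightarrow> (real \<times> real \<Rightarrow> real \<Rightarrow> real) \<Rightarrow> (real \<times> real \<Rightarrow> real \<Rightarrow> real)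
    \<Rightarrow> (nat \<Rightarrow> int \<Rightarrow> int \<Rightarrow> real) \<Rightarrow> ereal" where
  "costF T NT N f g m =
     (\<Sum>k = 1..NT. \<Sum>i = 0..<int N. \<Sum>j = 0..<int N. primitive f (gridpt N i j) (m k i j))
     + ereal (1 / tstep T NT) *
       (\<Sum>i = 0..<int N. \<Sum>j = 0..<int N. primitive g (gridpt N i j) (m NT i j))"

definition feasible ::
  "real \<Rightarrow> real \<Rightarrow> nat \<Rightarrow> nat \<Rightarrow> (int \<Rightarrow> int \<Rightarrow> real)
    \<Rightarrow> ((nat \<Rightarrow> int \<Rightarrow> int \<Rightarrow> real) \<times> (nat \<Rightarrow> int \<Rightarrow> int \<Rightarrow> real ^ 4)) set" where
  "feasible \<nu> T NT N mb =
     {(m, w). m \<in> spaceM NT N \<and> w \<in> spaceW NT N \<and>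
        (\<forall>k \<in> {0..<NT}. \<forall>i \<in> {0..<int N}. \<forall>j \<in> {0..<int N}.
           opA \<nu> T NT N m k i j + opB N w k i j = 0) \<and>
        (\<forall>i \<in> {0..<int N}. \<forall>j \<in> {0..<int N}. m 0 i j = mb i j)}"

text \<open>A feasible pair attaining the infimum, which moreover is finite.\<close>

definition is_solution ::
  "real \<Rightarrow> real \<Rightarrow> real \<Rightarrow> nat \<Rightarrow> nat \<Rightarrow> (real \<times> real \<Rightarrow> real \<Rightarrow> real)
    \<Rightarrow> (real \<times> real \<Rightarrow> real \<Rightarrow> real) \<Rightarrow> (int \<Rightarrow> int \<Rightarrow> real)
    \<Rightarrow> (nat \<Rightarrow> int \<Rightarrow> int \<Rightarrow> real) \<Rightarrow> (nat \<Rightarrow> int \<Rightarrow> int \<Rightarrow> real ^ 4) \<Rightarrow> bool" where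
  "is_solution q \<nu> T NT N f g mb m w \<longleftrightarrow>
     (m, w) \<in> feasible \<nu> T NT N mb \<and>
     costB q NT N m w + costF T NT N f g m =
       (INF (m', w') \<in> feasible \<nu> T NT N mb. costB q NT N m' w' + costF T NT N f g m') \<and>
     \<bar>costB q NT N m w + costF T NT N f g m\<bar> \<noteq> \<infinity>"

subsection \<open>The discrete mean field game system\<close>

definition mfg_system ::
  "real \<Rightarrow> real \<Rightarrow> real \<Rightarrow> nat \<Rightarrow> nat \<Rightarrow> (real \<times> real \<Rightarrow> real \<Rightarrow> real)
    \<Rightarrow> (real \<times> real \<Rightarrow> real \<Rightarrow> real) \<Rightarrow> (int \<Rightarrow> int \<Rightarrow> real)
    \<Rightarrow> (nat \<Rightarrow> int \<Rightarrow> int \<Rightarrow> real) \<Rightarrow> (nat \<Rightarrow> int \<Rightarrow> int \<Rightarrow> real) \<Rightarrow> bool" where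
  "mfg_system q \<nu> T NT N f g mb u m \<longleftrightarrow>
     (\<forall>i \<in> {0..<int N}. \<forall>j \<in> {0..<int N}.
        (\<forall>k \<in> {0..<NT}.
           - Dt T NT u k i j - \<nu> * Lap N (u k) i j
             + (1 / (q / (q - 1))) * norm (hatD N (u k) i j) powr (q / (q - 1))
             = f (gridpt N i j) (m (k + 1) i j) \<and>
           Dt T NT m k i j - \<nu> * Lap N (m (k + 1)) i j
             - transport q N (u k) (m (k + 1)) i j = 0) \<and>
        m 0 i j = mb i j \<and>
        u NT i j = g (gridpt N i j) (m NT i j))"

end

theory Submission
  imports Defs
begin

text \<open>
  The operator \<open>A\<close> is an implicit Euler step of the heat equation, hence bijective on densities
  vanishing at time \<open>0\<close>. Consequently no constraint qualification is needed: the multiplier \<open>u\<close> is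
  defined by solving the adjoint (backward, linear) heat equation in which the Hamiltonian term is
  replaced by \<open>|w|^q / (q' m^q)\<close>. Perturbing \<open>w\<close> at a single grid point and compensating with
  the density given by \<open>A\<close> inverse leaves a variational inequality on the cone \<open>K\<close> there, which says
  that \<open>|w|^(q - 2) w / m^(q - 1)\<close> is the projection of \<open>B\<^sup>* u\<close> onto \<open>K\<close>, i.e. \<open>hatD\<close> of \<open>u\<close>.

  These variations are legitimate because every feasible pair of finite cost has positive density
  after time \<open>0\<close>, by a discrete strong maximum principle. Positivity also makes the cost continuous on
  its sublevel sets, which are compact because mass is conserved, so a minimiser exists.
\<close>

subsection \<open>Periodic grid functions\<close>

text \<open>Since \<open>f\<close> and \<open>g\<close> are only continuous, the cost need not be
  convex in the density, and convex duality does not supply \<open>u\<close>. Optimality is read off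
  one-sided derivatives along admissible segments. The obstacle is nonlocality: changing
  \<open>w\<close> at one grid point in general changes the density at all points and all later
  times. The adjoint equation is chosen to cancel exactly this effect. Its source is the derivative
  of the running cost with respect to the density, \<open>f - |w|^q / (q' m^q)\<close>, and its
  terminal value is \<open>g\<close>, so all density contributions together become the pairing of
  \<open>u\<close> with \<open>A \<mu> = - B \<omega>\<close>, which is local again. The
  Hamilton-Jacobi equation is recovered only afterwards: the projection identity yields
  \<open>|hatD u| = (|w| / m)^(q - 1)\<close>, hence
  \<open>|hatD u|^q' = |w|^q / m^q\<close>.\<close>

lemma gridfunD:
  assumes "y \<in> gridfun N"
  shows "y (i + int N) j = y i j" "y i (j + int N) = y i j"
  using assms by (auto simp: gridfun_def)

lemma gridfun_mult_period:
  assumes y: "y \<in> gridfun N"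
  shows "y (i + c * int N) (j + d * int N) = y i j"
proof -
  have 1: "y (i + c * int N) j = y i j" for i j c
  proof (induction c rule: int_induct[where k = 0])
    case (step1 c)
    then show ?case
      using gridfunD(1)[OF y, of "i + c * int N" j] by (simp add: algebra_simps)
  next
    case (step2 c)
    then show ?case
      using gridfunD(1)[OF y, of "i + (c - 1) * int N" j] by (simp add: algebra_simps)
  qed simp
  have 2: "y i (j + d * int N) = y i j" for i j d
  proof (induction d rule: int_induct[where k = 0])
    case (step1 d)
    then show ?case
      using gridfunD(2)[OF y, of i "j + d * int N"] by (simp add: algebra_simps)
  next
    case (step2 d)
    then show ?case
      using gridfunD(2)[OF y, of i "j + (d - 1) * int N"] by (simp add: algebra_simps)
  qed simp
  show ?thesis by (simp add: 1 2)
qed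

lemma gridfun_mod:
  assumes y: "y \<in> gridfun N"
  shows "y (i mod int N) (j mod int N) = y i j"
  using gridfun_mult_period[OF y, of "i mod int N" "i div int N" "j mod int N" "j div int N"]
  by (simp add: mult.commute)

text \<open>A property of grid points is itself a grid function with truth values. This extends
  statements made on one period, as in the definition of feasibility, to all integer indices, where
  neighbours can be addressed without reduction.\<close>

lemma gridfun_everywhere:
  assumes P: "P \<in> gridfun N" and "N > 0"
    and "\<And>i j. i \<in> {0..<int N} \<Longrightarrow> j \<in> {0..<int N} \<Longrightarrow> P i j"
  shows "P i j"
  using assms(3)[of "i mod int N" "j mod int N"] \<open>N > 0\<close> gridfun_mod[OF P, of i j] by simp

lemma gridfun_shift:
  assumes "y \<in> gridfun N"
  shows "(\<lambda>i j. y (i + a) (j + b)) \<in> gridfun N"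
  using gridfunD[OF assms, of "i + a" "j + b" for i j]
  by (auto simp: gridfun_def algebra_simps)

lemma gridfun_shifts:
  assumes "y \<in> gridfun N"
  shows "(\<lambda>i j. y (i + a) j) \<in> gridfun N" "(\<lambda>i j. y i (j + a)) \<in> gridfun N"
    "(\<lambda>i j. y (i - a) j) \<in> gridfun N" "(\<lambda>i j. y i (j - a)) \<in> gridfun N"
  using gridfun_shift[OF assms, of a 0] gridfun_shift[OF assms, of 0 a]
    gridfun_shift[OF assms, of "- a" 0] gridfun_shift[OF assms, of 0 "- a"] by simp_all

lemma gridfun_const: "(\<lambda>i j. c) \<in> gridfun N"
  by (simp add: gridfun_def)

lemma gridfun_comp: "y \<in> gridfun N \<Longrightarrow> (\<lambda>i j. F (y i j)) \<in> gridfun N"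
  by (simp add: gridfun_def)

lemma gridfun_comp2:
  "y \<in> gridfun N \<Longrightarrow> z \<in> gridfun N \<Longrightarrow> (\<lambda>i j. F (y i j) (z i j)) \<in> gridfun N"
  by (simp add: gridfun_def)

lemma gridfun_D:
  assumes "y \<in> gridfun N"
  shows "D1 N y \<in> gridfun N" "D2 N y \<in> gridfun N"
proof -
  have "(\<lambda>i j. (y (i + 1) j - y i j) / mesh N) \<in> gridfun N"
    "(\<lambda>i j. (y i (j + 1) - y i j) / mesh N) \<in> gridfun N"
    using gridfun_shifts[OF assms, of 1] assms by (simp_all add: gridfun_def)
  then show "D1 N y \<in> gridfun N" "D2 N y \<in> gridfun N"
    by (simp_all add: D1_def[abs_def] D2_def[abs_def])
qed

lemma gridfun_Lap:
  assumes "y \<in> gridfun N"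
  shows "Lap N y \<in> gridfun N"
  using gridfun_shifts[OF assms, of 1] assms by (simp add: gridfun_def Lap_def)

lemma gridfun_hatD:
  assumes "y \<in> gridfun N"
  shows "hatD N y \<in> gridfun N"
  using gridfun_shifts[OF gridfun_D(1)[OF assms], of 1] gridfun_D[OF assms]
    gridfun_shifts[OF gridfun_D(2)[OF assms], of 1]
  by (simp add: gridfun_def hatD_def)

lemma gridfun_opB:
  assumes "w k \<in> gridfun N"
  shows "opB N w k \<in> gridfun N"
proof -
  have c: "(\<lambda>i j. w k i j $ a) \<in> gridfun N" for a :: 4
    using assms by (rule gridfun_comp)
  show ?thesis
    using gridfun_shifts[OF gridfun_D(1)[OF c[of 1]], of 1] gridfun_D(1)[OF c[of 2]]
      gridfun_shifts[OF gridfun_D(2)[OF c[of 3]], of 1] gridfun_D(2)[OF c[of 4]]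
    by (simp add: gridfun_def opB_def)
qed

lemma gridfun_opA:
  assumes "m k \<in> gridfun N" "m (Suc k) \<in> gridfun N"
  shows "opA \<nu> T NT N m k \<in> gridfun N"
  using gridfun_Lap[OF assms(2)] assms by (simp add: gridfun_def opA_def Dt_def)

lemma finite_range_gridfun:
  assumes "y \<in> gridfun N" "N > 0"
  shows "finite {y i j |i j. True}"
proof -
  have "{y i j |i j. True} \<subseteq> (\<lambda>(i, j). y i j) ` ({0..<int N} \<times> {0..<int N})"
  proof clarify
    fix i j
    show "y i j \<in> (\<lambda>(i, j). y i j) ` ({0..<int N} \<times> {0..<int N})"
      using gridfun_mod[OF assms(1), of i j] \<open>N > 0\<close>
      by (intro image_eqI[of _ _ "(i mod int N, j mod int N)"]) auto
  qed
  then show ?thesis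
    by (rule finite_subset) simp
qed

lemma gridfun_bounded:
  fixes y :: "int \<Rightarrow> int \<Rightarrow> real"
  assumes "y \<in> gridfun N" "N > 0"
  obtains R where "\<And>i j. \<bar>y i j\<bar> \<le> R"
proof -
  have "finite (abs ` {y i j |i j. True})"
    using finite_range_gridfun[OF assms] by simp
  then have "\<bar>y i j\<bar> \<le> Max (abs ` {y i j |i j. True})" for i j
    by (intro Max_ge) auto
  then show ?thesis by (rule that)
qed

subsection \<open>Summation over one period\<close>

definition gsum :: "nat \<Rightarrow> (int \<Rightarrow> int \<Rightarrow> real) \<Rightarrow> real" where
  "gsum N y = (\<Sum>i = 0..<int N. \<Sum>j = 0..<int N. y i j)"

lemma sum_periodic_shift:
  fixes p :: "int \<Rightarrow> real"
  assumes "p (int N) = p 0"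
  shows "(\<Sum>i = 0..<int N. p (i + 1)) = (\<Sum>i = 0..<int N. p i)"
proof -
  have 1: "(\<Sum>i = 0..<int n. p (i + 1)) + p 0 = (\<Sum>i = 0..<int n. p i) + p (int n)" for n
  proof (induction n)
    case (Suc n)
    have "{0..<int (Suc n)} = insert (int n) {0..<int n}" by auto
    then show ?case using Suc by (simp add: algebra_simps)
  qed simp
  show ?thesis using 1[of N] assms by simp
qed

lemma gsum_shift:
  assumes "y \<in> gridfun N"
  shows "gsum N (\<lambda>i j. y (i + 1) j) = gsum N y" "gsum N (\<lambda>i j. y i (j + 1)) = gsum N y"
    "gsum N (\<lambda>i j. y (i - 1) j) = gsum N y" "gsum N (\<lambda>i j. y i (j - 1)) = gsum N y"
proof -
  have 1: "gsum N (\<lambda>i j. y (i + 1) j) = gsum N y" if "y \<in> gridfun N" for y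
    unfolding gsum_def using gridfunD[OF that, of 0]
    by (intro sum_periodic_shift[of "\<lambda>i. \<Sum>j = 0..<int N. y i j"]) simp
  have 2: "gsum N (\<lambda>i j. y i (j + 1)) = gsum N y" if "y \<in> gridfun N" for y
    unfolding gsum_def using gridfunD[OF that, of _ 0]
    by (intro sum.cong sum_periodic_shift) auto
  show "gsum N (\<lambda>i j. y (i + 1) j) = gsum N y" "gsum N (\<lambda>i j. y i (j + 1)) = gsum N y"
    using 1 2 assms by auto
  show "gsum N (\<lambda>i j. y (i - 1) j) = gsum N y" "gsum N (\<lambda>i j. y i (j - 1)) = gsum N y"
    using 1[OF gridfun_shifts(3)[OF assms, of 1]] 2[OF gridfun_shifts(4)[OF assms, of 1]] by auto
qed

lemma gsum_add: "gsum N (\<lambda>i j. y i j + z i j) = gsum N y + gsum N z"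
  by (simp add: gsum_def sum.distrib)

lemma gsum_diff: "gsum N (\<lambda>i j. y i j - z i j) = gsum N y - gsum N z"
  by (simp add: gsum_def sum_subtractf)

lemma gsum_cmult: "gsum N (\<lambda>i j. c * y i j) = c * gsum N y"
  by (simp add: gsum_def sum_distrib_left)

lemma gsum_divide: "gsum N (\<lambda>i j. y i j / c) = gsum N y / c"
  by (simp add: gsum_def sum_divide_distrib)

lemma gsum_cong:
  "(\<And>i j. i \<in> {0..<int N} \<Longrightarrow> j \<in> {0..<int N} \<Longrightarrow> y i j = z i j) \<Longrightarrow> gsum N y = gsum N z"
  by (auto simp: gsum_def intro!: sum.cong)

lemma gsum_single:
  assumes "i0 \<in> {0..<int N}" "j0 \<in> {0..<int N}"
    and "\<And>i j. i \<in> {0..<int N} \<Longrightarrow> j \<in> {0..<int N} \<Longrightarrow> (i, j) \<noteq> (i0, j0) \<Longrightarrow> y i j = 0"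
  shows "gsum N y = y i0 j0"
proof -
  have "gsum N y = (\<Sum>(i, j) \<in> {0..<int N} \<times> {0..<int N}. y i j)"
    by (simp add: gsum_def sum.cartesian_product)
  also have "\<dots> = (\<Sum>(i, j) \<in> {(i0, j0)}. y i j)"
    using assms by (intro sum.mono_neutral_right) (auto, (metis atLeastLessThan_iff prod.inject)+)
  finally show ?thesis by simp
qed

lemma member_le_gsum:
  assumes "\<And>i j. y i j \<ge> 0" "i \<in> {0..<int N}" "j \<in> {0..<int N}"
  shows "y i j \<le> gsum N y"
proof -
  have "y i j \<le> (\<Sum>j = 0..<int N. y i j)"
    using assms by (intro member_le_sum) auto
  also have "\<dots> \<le> gsum N y"
    unfolding gsum_def using assms
    by (intro member_le_sum[of i _ "\<lambda>i. \<Sum>j = 0..<int N. y i j"]) (auto intro: sum_nonneg)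
  finally show ?thesis .
qed

text \<open>Discrete Green formula: moving a shift to the other factor reverses its direction, and
  the five-point stencil is invariant under this reversal.\<close>

lemma gsum_Lap_symmetric:
  assumes y: "y \<in> gridfun N" and z: "z \<in> gridfun N"
  shows "gsum N (\<lambda>i j. Lap N y i j * z i j) = gsum N (\<lambda>i j. y i j * Lap N z i j)"
proof -
  have s: "gsum N (\<lambda>i j. y (i + 1) j * z i j) = gsum N (\<lambda>i j. y i j * z (i - 1) j)"
    "gsum N (\<lambda>i j. y (i - 1) j * z i j) = gsum N (\<lambda>i j. y i j * z (i + 1) j)"
    "gsum N (\<lambda>i j. y i (j + 1) * z i j) = gsum N (\<lambda>i j. y i j * z i (j - 1))"
    "gsum N (\<lambda>i j. y i (j - 1) * z i j) = gsum N (\<lambda>i j. y i j * z i (j + 1))"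
    using gsum_shift(1)[OF gridfun_comp2[OF y gridfun_shifts(3)[OF z, of 1], of "(*)"]]
      gsum_shift(3)[OF gridfun_comp2[OF y gridfun_shifts(1)[OF z, of 1], of "(*)"]]
      gsum_shift(2)[OF gridfun_comp2[OF y gridfun_shifts(4)[OF z, of 1], of "(*)"]]
      gsum_shift(4)[OF gridfun_comp2[OF y gridfun_shifts(2)[OF z, of 1], of "(*)"]]
    by simp_all
  have e: "gsum N (\<lambda>i j. Lap N a i j * b i j) =
    - (1 / (mesh N)\<^sup>2) * (4 * gsum N (\<lambda>i j. a i j * b i j) - gsum N (\<lambda>i j. a (i + 1) j * b i j)
      - gsum N (\<lambda>i j. a (i - 1) j * b i j) - gsum N (\<lambda>i j. a i (j + 1) * b i j)
      - gsum N (\<lambda>i j. a i (j - 1) * b i j))" for a b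
    unfolding gsum_cmult[symmetric] gsum_diff[symmetric]
    by (rule gsum_cong) (simp add: Lap_def algebra_simps)
  have "gsum N (\<lambda>i j. y i j * Lap N z i j) = gsum N (\<lambda>i j. Lap N z i j * y i j)"
    by (simp add: mult.commute)
  then show ?thesis
    unfolding e using s by (simp add: mult.commute)
qed

text \<open>Forward and backward differences are negative transposes of each other; periodicity
  removes the boundary terms.\<close>

lemma gsum_D_by_parts:
  assumes y: "y \<in> gridfun N" and z: "z \<in> gridfun N"
  shows "gsum N (\<lambda>i j. y i j * D1 N z (i - 1) j) = - gsum N (\<lambda>i j. D1 N y i j * z i j)"
    "gsum N (\<lambda>i j. y i j * D1 N z i j) = - gsum N (\<lambda>i j. D1 N y (i - 1) j * z i j)"
    "gsum N (\<lambda>i j. y i j * D2 N z i (j - 1)) = - gsum N (\<lambda>i j. D2 N y i j * z i j)"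
    "gsum N (\<lambda>i j. y i j * D2 N z i j) = - gsum N (\<lambda>i j. D2 N y i (j - 1) * z i j)"
proof -
  have s: "gsum N (\<lambda>i j. y (i + 1) j * z i j) = gsum N (\<lambda>i j. y i j * z (i - 1) j)"
    "gsum N (\<lambda>i j. y (i - 1) j * z i j) = gsum N (\<lambda>i j. y i j * z (i + 1) j)"
    "gsum N (\<lambda>i j. y i (j + 1) * z i j) = gsum N (\<lambda>i j. y i j * z i (j - 1))"
    "gsum N (\<lambda>i j. y i (j - 1) * z i j) = gsum N (\<lambda>i j. y i j * z i (j + 1))"
    using gsum_shift(1)[OF gridfun_comp2[OF y gridfun_shifts(3)[OF z, of 1], of "(*)"]]
      gsum_shift(3)[OF gridfun_comp2[OF y gridfun_shifts(1)[OF z, of 1], of "(*)"]]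
      gsum_shift(2)[OF gridfun_comp2[OF y gridfun_shifts(4)[OF z, of 1], of "(*)"]]
      gsum_shift(4)[OF gridfun_comp2[OF y gridfun_shifts(2)[OF z, of 1], of "(*)"]]
    by simp_all
  show "gsum N (\<lambda>i j. y i j * D1 N z (i - 1) j) = - gsum N (\<lambda>i j. D1 N y i j * z i j)"
    "gsum N (\<lambda>i j. y i j * D1 N z i j) = - gsum N (\<lambda>i j. D1 N y (i - 1) j * z i j)"
    "gsum N (\<lambda>i j. y i j * D2 N z i (j - 1)) = - gsum N (\<lambda>i j. D2 N y i j * z i j)"
    "gsum N (\<lambda>i j. y i j * D2 N z i j) = - gsum N (\<lambda>i j. D2 N y i (j - 1) * z i j)"
    using s by (simp_all add: D1_def D2_def right_diff_distrib left_diff_distrib gsum_diff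
        gsum_divide times_divide_eq_right times_divide_eq_left diff_divide_distrib)
qed

lemma gsum_Lap_eq_0:
  assumes "y \<in> gridfun N"
  shows "gsum N (Lap N y) = 0"
proof -
  have "Lap N (\<lambda>i j. 1) i j = 0" for i j
    by (simp add: Lap_def)
  then show ?thesis
    using gsum_Lap_symmetric[OF assms gridfun_const[of 1]] by (simp add: gsum_def)
qed

text \<open>The transpose of \<open>opB\<close> for the sum over one period. Its components are
  those of \<open>hatD\<close> before positive and negative parts are taken.\<close>

definition adjB :: "nat \<Rightarrow> (int \<Rightarrow> int \<Rightarrow> real) \<Rightarrow> int \<Rightarrow> int \<Rightarrow> real ^ 4" where
  "adjB N y i j = vector [- D1 N y i j, - D1 N y (i - 1) j, - D2 N y i j, - D2 N y i (j - 1)]"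

lemma vector_4 [simp]:
  "(vector [a, b, c, d] :: 'a::zero ^ 4) $ 1 = a" "(vector [a, b, c, d] :: 'a ^ 4) $ 2 = b"
  "(vector [a, b, c, d] :: 'a ^ 4) $ 3 = c" "(vector [a, b, c, d] :: 'a ^ 4) $ 4 = d"
  unfolding vector_def by simp_all

lemma inner_vec4:
  fixes v w :: "real ^ 4"
  shows "v \<bullet> w = v $ 1 * w $ 1 + v $ 2 * w $ 2 + v $ 3 * w $ 3 + v $ 4 * w $ 4"
  by (simp add: inner_vec_def sum_4)

lemma gsum_opB_adjoint:
  assumes y: "y \<in> gridfun N" and w: "w k \<in> gridfun N"
  shows "gsum N (\<lambda>i j. y i j * opB N w k i j) = gsum N (\<lambda>i j. adjB N y i j \<bullet> w k i j)"
proof -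
  have c: "(\<lambda>i j. w k i j $ a) \<in> gridfun N" for a :: 4
    using w by (rule gridfun_comp)
  have "gsum N (\<lambda>i j. y i j * opB N w k i j) =
     gsum N (\<lambda>i j. y i j * D1 N (\<lambda>i j. w k i j $ 1) (i - 1) j)
     + gsum N (\<lambda>i j. y i j * D1 N (\<lambda>i j. w k i j $ 2) i j)
     + gsum N (\<lambda>i j. y i j * D2 N (\<lambda>i j. w k i j $ 3) i (j - 1))
     + gsum N (\<lambda>i j. y i j * D2 N (\<lambda>i j. w k i j $ 4) i j)"
    by (simp add: opB_def distrib_left gsum_add)
  also have "\<dots> = - gsum N (\<lambda>i j. D1 N y i j * w k i j $ 1)
     - gsum N (\<lambda>i j. D1 N y (i - 1) j * w k i j $ 2)
     - gsum N (\<lambda>i j. D2 N y i j * w k i j $ 3)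
     - gsum N (\<lambda>i j. D2 N y i (j - 1) * w k i j $ 4)"
    by (simp add: gsum_D_by_parts[OF y c])
  also have "\<dots> = gsum N (\<lambda>i j. adjB N y i j \<bullet> w k i j)"
    by (simp add: adjB_def inner_vec4 gsum_def sum_subtractf sum_negf)
  finally show ?thesis .
qed

text \<open>Testing with the constant 1, whose differences vanish: a discrete divergence carries no
  net mass.\<close>

lemma gsum_opB_eq_0:
  assumes "w k \<in> gridfun N"
  shows "gsum N (opB N w k) = 0"
proof -
  have "adjB N (\<lambda>i j. 1) i j \<bullet> v = 0" for i j v
    by (simp add: adjB_def inner_vec4 D1_def D2_def)
  then show ?thesis
    using gsum_opB_adjoint[where y = "\<lambda>i j. 1" and w = w and k = k, OF gridfun_const assms] by (simp add: gsum_def)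
qed

subsection \<open>The implicit heat equation\<close>

text \<open>Neumann series for the inverse of \<open>y \<mapsto> (1 + 4 c) y - c (sum of the four neighbours)\<close>.\<close>

primrec heat_term :: "real \<Rightarrow> (int \<Rightarrow> int \<Rightarrow> real) \<Rightarrow> nat \<Rightarrow> int \<Rightarrow> int \<Rightarrow> real" where
  "heat_term c r 0 = (\<lambda>i j. r i j / (1 + 4 * c))"
| "heat_term c r (Suc n) = (\<lambda>i j. c / (1 + 4 * c) *
     (heat_term c r n (i + 1) j + heat_term c r n (i - 1) j
      + heat_term c r n i (j + 1) + heat_term c r n i (j - 1)))"

definition heat_solve :: "real \<Rightarrow> (int \<Rightarrow> int \<Rightarrow> real) \<Rightarrow> int \<Rightarrow> int \<Rightarrow> real" where
  "heat_solve c r i j = (\<Sum>n. heat_term c r n i j)"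

lemma gridfun_heat_term: "r \<in> gridfun N \<Longrightarrow> heat_term c r n \<in> gridfun N"
proof (induction n)
  case 0
  then show ?case by (simp add: gridfun_def)
next
  case (Suc n)
  from gridfun_shifts[OF Suc.IH[OF Suc.prems], of 1] show ?case
    by (simp add: gridfun_def)
qed

lemma gridfun_heat_solve:
  assumes "r \<in> gridfun N"
  shows "heat_solve c r \<in> gridfun N"
  using gridfunD[OF gridfun_heat_term[OF assms]] by (simp add: gridfun_def heat_solve_def)

lemma summable_heat_term:
  assumes "c \<ge> 0" "r \<in> gridfun N" "N > 0"
  shows "summable (\<lambda>n. heat_term c r n i j)"
proof -
  obtain R where R: "\<And>i j. \<bar>r i j\<bar> \<le> R"
    using gridfun_bounded[OF assms(2,3)] by blast
  \<comment> \<open>The contraction ratio of the series: four neighbours with weight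
    \<open>c\<close> against the diagonal \<open>1 + 4 * c\<close>.\<close>
  define \<theta> where "\<theta> = 4 * c / (1 + 4 * c)"
  have \<theta>: "0 \<le> \<theta>" "\<theta> < 1" using \<open>c \<ge> 0\<close> by (auto simp: \<theta>_def field_simps)
  have sum4: "\<bar>a1 + a2 + a3 + a4\<bar> \<le> 4 * b"
    if "\<bar>a1\<bar> \<le> b" "\<bar>a2\<bar> \<le> b" "\<bar>a3\<bar> \<le> b" "\<bar>a4\<bar> \<le> b" for a1 a2 a3 a4 b :: real
    using that by linarith
  have bound: "\<bar>heat_term c r n i j\<bar> \<le> \<theta> ^ n * (R / (1 + 4 * c))" for n i j
  proof (induction n arbitrary: i j)
    case 0
    show ?case using R[of i j] \<open>c \<ge> 0\<close> by (simp add: divide_right_mono)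
  next
    case (Suc n)
    let ?h = "heat_term c r n" and ?b = "\<theta> ^ n * (R / (1 + 4 * c))"
    have "\<bar>?h (i + 1) j + ?h (i - 1) j + ?h i (j + 1) + ?h i (j - 1)\<bar> \<le> 4 * ?b"
      using Suc by (intro sum4)
    then have "c / (1 + 4 * c) * \<bar>?h (i + 1) j + ?h (i - 1) j + ?h i (j + 1) + ?h i (j - 1)\<bar>
      \<le> c / (1 + 4 * c) * (4 * ?b)"
      using \<open>c \<ge> 0\<close> by (intro mult_left_mono) auto
    then show ?case
      using \<open>c \<ge> 0\<close> by (simp add: abs_mult \<theta>_def mult_ac)
  qed
  have "summable (\<lambda>n. \<theta> ^ n * (R / (1 + 4 * c)))"
    using \<theta> by (intro summable_mult2 summable_geometric) auto
  then show ?thesis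
    by (rule summable_comparison_test') (use bound in auto)
qed

text \<open>After the zeroth term is split off, the rest of the series is the neighbour average
  applied to the series itself; clearing the factor \<open>1 + 4 * c\<close> gives the
  equation.\<close>

lemma heat_solve_eq:
  assumes "c \<ge> 0" "r \<in> gridfun N" "N > 0"
  shows "(1 + 4 * c) * heat_solve c r i j - c * (heat_solve c r (i + 1) j + heat_solve c r (i - 1) j
     + heat_solve c r i (j + 1) + heat_solve c r i (j - 1)) = r i j"
proof -
  note s = summable_heat_term[OF assms]
  have "heat_solve c r i j = heat_term c r 0 i j + (\<Sum>n. heat_term c r (Suc n) i j)"
    unfolding heat_solve_def using suminf_split_head[OF s, of i j] by simp
  also have "(\<Sum>n. heat_term c r (Suc n) i j) = c / (1 + 4 * c) *
     (heat_solve c r (i + 1) j + heat_solve c r (i - 1) j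
      + heat_solve c r i (j + 1) + heat_solve c r i (j - 1))"
    unfolding heat_solve_def heat_term.simps
    by (subst suminf_mult) (simp_all add: suminf_add[symmetric] s summable_add)
  finally have "heat_solve c r i j = (r i j + c * (heat_solve c r (i + 1) j
      + heat_solve c r (i - 1) j + heat_solve c r i (j + 1) + heat_solve c r i (j - 1))) / (1 + 4 * c)"
    by (simp add: add_divide_distrib)
  moreover have "x = b / a \<Longrightarrow> a * x = b" if "a \<noteq> 0" for a b x :: real
    using that by simp
  ultimately show ?thesis
    using \<open>c \<ge> 0\<close> by (smt (verit))
qed

text \<open>The weak maximum principle is visible in the series, all of whose terms are
  nonnegative.\<close>

lemma heat_solve_nonneg:
  assumes "c \<ge> 0" "r \<in> gridfun N" "N > 0" "\<And>i j. r i j \<ge> 0"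
  shows "heat_solve c r i j \<ge> 0"
proof -
  have "heat_term c r n i j \<ge> 0" for n i j
    by (induction n arbitrary: i j) (use assms in auto)
  then show ?thesis
    unfolding heat_solve_def using summable_heat_term[OF assms(1-3)] by (intro suminf_nonneg)
qed

text \<open>Implicit Euler with initial value \<open>y\<close> and source \<open>s k\<close> in the
  step from \<open>k\<close> to \<open>Suc k\<close>; multiplying that step by \<open>\<tau>\<close>
  produces the coefficient \<open>\<nu> * \<tau> / (mesh N)\<^sup>2\<close>. It serves for the
  uncontrolled density, for the density compensating a change of flux and, with time reversed, for
  the adjoint state.\<close>

primrec heat_flow ::
  "nat \<Rightarrow> real \<Rightarrow> real \<Rightarrow> (nat \<Rightarrow> int \<Rightarrow> int \<Rightarrow> real) \<Rightarrow> (int \<Rightarrow> int \<Rightarrow> real) \<Rightarrow> nat \<Rightarrow> int \<Rightarrow> int \<Rightarrow> real"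
  where
  "heat_flow N \<nu> \<tau> s y 0 = y"
| "heat_flow N \<nu> \<tau> s y (Suc k) =
     heat_solve (\<nu> * \<tau> / (mesh N)\<^sup>2) (\<lambda>i j. heat_flow N \<nu> \<tau> s y k i j + \<tau> * s k i j)"

lemma gridfun_heat_flow:
  assumes "y \<in> gridfun N" "\<And>k. s k \<in> gridfun N"
  shows "heat_flow N \<nu> \<tau> s y k \<in> gridfun N"
proof (induction k)
  case (Suc k)
  then have "(\<lambda>i j. heat_flow N \<nu> \<tau> s y k i j + \<tau> * s k i j) \<in> gridfun N"
    using assms(2)[of k] by (rule gridfun_comp2)
  then show ?case by (simp add: gridfun_heat_solve)
qed (simp add: assms)

lemma heat_flow_eq:
  assumes "y \<in> gridfun N" "\<And>k. s k \<in> gridfun N" "N > 0" "\<nu> \<ge> 0" "\<tau> > 0"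
  shows "(heat_flow N \<nu> \<tau> s y (Suc k) i j - heat_flow N \<nu> \<tau> s y k i j) / \<tau>
    - \<nu> * Lap N (heat_flow N \<nu> \<tau> s y (Suc k)) i j = s k i j"
proof -
  let ?c = "\<nu> * \<tau> / (mesh N)\<^sup>2" and ?y = "heat_flow N \<nu> \<tau> s y"
  have r: "(\<lambda>i j. ?y k i j + \<tau> * s k i j) \<in> gridfun N"
    by (rule gridfun_comp2[OF gridfun_heat_flow[OF assms(1,2)] assms(2)])
  have "(1 + 4 * ?c) * ?y (Suc k) i j - ?c * (?y (Suc k) (i + 1) j + ?y (Suc k) (i - 1) j
     + ?y (Suc k) i (j + 1) + ?y (Suc k) i (j - 1)) = ?y k i j + \<tau> * s k i j"
    using heat_solve_eq[OF _ r \<open>N > 0\<close>, of ?c i j] assms(4,5) by simp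
  moreover have "\<tau> * (\<nu> * Lap N (?y (Suc k)) i j) =
      - ?c * (4 * ?y (Suc k) i j - ?y (Suc k) (i + 1) j - ?y (Suc k) (i - 1) j
        - ?y (Suc k) i (j + 1) - ?y (Suc k) i (j - 1))"
    by (simp add: Lap_def del: heat_flow.simps)
  ultimately have "?y (Suc k) i j - ?y k i j - \<tau> * (\<nu> * Lap N (?y (Suc k)) i j) = \<tau> * s k i j"
    by (simp add: algebra_simps del: heat_flow.simps)
  then show ?thesis
    using \<open>\<tau> > 0\<close> by (simp add: field_simps del: heat_flow.simps)
qed

lemma heat_flow_nonneg:
  assumes "y \<in> gridfun N" "\<And>k. s k \<in> gridfun N" "N > 0" "\<nu> \<ge> 0" "\<tau> > 0"
    and "\<And>i j. y i j \<ge> 0" "\<And>k i j. s k i j \<ge> 0"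
  shows "heat_flow N \<nu> \<tau> s y k i j \<ge> 0"
proof (induction k arbitrary: i j)
  case (Suc k)
  have "(\<lambda>i j. heat_flow N \<nu> \<tau> s y k i j + \<tau> * s k i j) \<in> gridfun N"
    by (rule gridfun_comp2[OF gridfun_heat_flow[OF assms(1,2)] assms(2)])
  then show ?case
    using Suc assms by (auto intro!: heat_solve_nonneg[of _ _ N])
qed (simp add: assms)

subsection \<open>Feasible pairs\<close>

lemma bhat_finiteD:
  "bhat q m w \<noteq> \<infinity> \<Longrightarrow> m \<ge> 0 \<and> w \<in> coneK \<and> (m = 0 \<longrightarrow> w = 0)"
  by (auto simp: bhat_def coneK_def split: if_splits)

text \<open>The initial density enters only through its cell averages \<open>mb\<close>. A single
  positive average encodes that the conserved mass is positive.\<close>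

locale discrete_mfg =
  fixes q \<nu> T :: real
    and NT N :: nat
    and f g :: "real \<times> real \<Rightarrow> real \<Rightarrow> real"
    and mb :: "int \<Rightarrow> int \<Rightarrow> real"
  assumes q: "q > 1" and T: "T > 0" and nu: "\<nu> > 0" and NT: "NT > 0" and N: "N > 0"
    and f_periodic: "torus_periodic f" and f_cont: "continuous_on UNIV (\<lambda>(x, s). f x s)"
    and g_periodic: "torus_periodic g" and g_cont: "continuous_on UNIV (\<lambda>(x, s). g x s)"
    and mb_grid: "mb \<in> gridfun N" and mb_nonneg: "mb i j \<ge> 0" and mb_pos: "\<exists>i j. mb i j > 0"
begin

text \<open>Feasibility at all integer indices and without extensionality in time, so that pairs
  given by formulas can be inserted directly.\<close>

definition dynamics where
  "dynamics m w \<longleftrightarrow> (\<forall>k\<le>NT. m k \<in> gridfun N) \<and> (\<forall>k<NT. w k \<in> gridfun N) \<and> m 0 = mb \<and>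
     (\<forall>k<NT. \<forall>i j. opA \<nu> T NT N m k i j + opB N w k i j = 0)"

text \<open>The effective domain of \<open>bhat\<close>, with the two cases of its definition merged
  (\<open>0\<close> lies in \<open>coneK\<close>).\<close>

definition controlled where
  "controlled m w \<longleftrightarrow> (\<forall>k<NT. \<forall>i j. m (Suc k) i j \<ge> 0 \<and> (w k i j :: real ^ 4) \<in> coneK \<and>
     (m (Suc k) i j = (0 :: real) \<longrightarrow> w k i j = 0))"

text \<open>The real-valued form of the objective, used once the density is known to be positive
  after time 0.\<close>

definition cost where
  "cost m w =
     (\<Sum>k<NT. gsum N (\<lambda>i j. norm (w k i j :: real ^ 4) powr q / (q * m (Suc k) i j powr (q - 1)) +
        integral {0..m (Suc k) i j} (f (gridpt N i j)))) +
     1 / tstep T NT * gsum N (\<lambda>i j. integral {0..m NT i j} (g (gridpt N i j)))"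

lemma tstep_pos: "tstep T NT > 0"
  using T NT by (simp add: tstep_def)

lemma mesh_pos: "mesh N > 0"
  using N by (simp add: mesh_def)

lemma dynamicsD:
  assumes "dynamics m w"
  shows "k \<le> NT \<Longrightarrow> m k \<in> gridfun N" "k < NT \<Longrightarrow> m (Suc k) \<in> gridfun N"
    "k < NT \<Longrightarrow> w k \<in> gridfun N" "m 0 = mb"
    "k < NT \<Longrightarrow> opA \<nu> T NT N m k i j + opB N w k i j = 0"
  using assms by (auto simp: dynamics_def)

lemma dynamics_cong:
  assumes "\<And>k. k \<le> NT \<Longrightarrow> m k = m' k" "\<And>k. k < NT \<Longrightarrow> w k = w' k"
  shows "dynamics m w \<longleftrightarrow> dynamics m' w'"
  using assms by (simp add: dynamics_def opA_def opB_def Dt_def)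

lemma controlled_cong:
  assumes "\<And>k. k \<le> NT \<Longrightarrow> m k = m' k" "\<And>k. k < NT \<Longrightarrow> w k = w' k"
  shows "controlled m w \<longleftrightarrow> controlled m' w'"
  using assms by (simp add: controlled_def)

lemma cost_cong:
  assumes "\<And>k. k \<le> NT \<Longrightarrow> m k = m' k" "\<And>k. k < NT \<Longrightarrow> w k = w' k"
  shows "cost m w = cost m' w'"
  using assms by (simp add: cost_def)

lemma feasible_dynamics:
  assumes "(m, w) \<in> feasible \<nu> T NT N mb"
  shows "dynamics m w"
proof -
  have m: "m k \<in> gridfun N" if "k \<le> NT" for k
    using assms that PiE_mem[of m "{0..NT}" "\<lambda>_. gridfun N" k] by (simp add: feasible_def spaceM_def)
  have w: "w k \<in> gridfun N" if "k < NT" for k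
    using assms that PiE_mem[of w "{0..<NT}" "\<lambda>_. gridfun N" k] by (simp add: feasible_def spaceW_def)
  have "opA \<nu> T NT N m k i j + opB N w k i j = 0" if "k < NT" for k i j
  proof (rule gridfun_everywhere[OF _ N])
    show "(\<lambda>i j. opA \<nu> T NT N m k i j + opB N w k i j = 0) \<in> gridfun N"
      using m[of k] m[of "Suc k"] w[of k] that
      by (intro gridfun_comp2[where F = "\<lambda>a b. a + b = 0"] gridfun_opA gridfun_opB) auto
  qed (use assms that in \<open>auto simp: feasible_def\<close>)
  moreover have "m 0 = mb"
  proof (rule ext, rule ext, rule gridfun_everywhere[where P = "\<lambda>i j. m 0 i j = mb i j", OF _ N])
    show "(\<lambda>i j. m 0 i j = mb i j) \<in> gridfun N"
      using m[of 0] mb_grid by (intro gridfun_comp2[where F = "(=)"]) auto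
  qed (use assms in \<open>auto simp: feasible_def\<close>)
  ultimately show ?thesis using m w by (auto simp: dynamics_def)
qed

lemma dynamics_feasible:
  assumes "dynamics m w"
  shows "(restrict m {0..NT}, restrict w {0..<NT}) \<in> feasible \<nu> T NT N mb"
proof -
  have "dynamics (restrict m {0..NT}) (restrict w {0..<NT})"
    using assms by (subst dynamics_cong[of _ m _ w]) auto
  then show ?thesis
    by (auto simp: feasible_def spaceM_def spaceW_def dynamics_def)
qed

text \<open>Summing the equation over one period kills the Laplacian and the divergence, leaving
  only the time difference.\<close>

lemma dynamics_mass:
  assumes "dynamics m w" "k \<le> NT"
  shows "gsum N (m k) = gsum N mb"
  using assms(2)
proof (induction k)
  case 0
  then show ?case using dynamicsD(4)[OF assms(1)] by simp
next
  case (Suc k)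
  then have k: "k < NT" by simp
  have eq: "opA \<nu> T NT N m k i j + opB N w k i j = 0" for i j
    by (rule dynamicsD(5)[OF assms(1) k])
  have "0 = gsum N (\<lambda>i j. opA \<nu> T NT N m k i j + opB N w k i j)"
    by (simp add: eq gsum_def)
  also have "\<dots> = (gsum N (m (Suc k)) - gsum N (m k)) / tstep T NT
      - \<nu> * gsum N (Lap N (m (Suc k))) + gsum N (opB N w k)"
    by (simp add: gsum_add opA_def gsum_diff Dt_def gsum_cmult gsum_divide)
  also have "\<dots> = (gsum N (m (Suc k)) - gsum N (m k)) / tstep T NT"
    using dynamicsD[OF assms(1)] k by (simp add: gsum_Lap_eq_0 gsum_opB_eq_0)
  finally show ?case
    using Suc k tstep_pos by simp
qed

lemma mass_pos: "gsum N mb > 0"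
proof -
  obtain i j where "mb i j > 0" using mb_pos by blast
  moreover have "mb (i mod int N) (j mod int N) \<le> gsum N mb"
    using N mb_nonneg by (intro member_le_gsum) auto
  ultimately show ?thesis using gridfun_mod[OF mb_grid, of i j] by simp
qed

text \<open>Discrete strong maximum principle: at a zero of \<open>m\<close> the fluxes out of that point vanish,
  so the equation there is a sum of nonpositive terms; hence \<open>m\<close> vanishes at the neighbours too.\<close>

lemma dynamics_positive:
  assumes dyn: "dynamics m w" and ctl: "controlled m w" and k: "k < NT"
  shows "m (Suc k) i j > 0"
proof (rule ccontr)
  let ?y = "m (Suc k)"
  have y: "?y \<in> gridfun N" using dynamicsD(2)[OF dyn k] .
  have y_nonneg: "?y i j \<ge> 0" for i j
    using ctl k by (auto simp: controlled_def)
  \<comment> \<open>\<open>controlled\<close> speaks only of times after 0; for \<open>k = 0\<close>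
    the sign comes from the initial averages.\<close>
  have m_nonneg: "m k i j \<ge> 0" for i j
    using ctl k mb_nonneg dynamicsD(4)[OF dyn] by (cases k) (auto simp: controlled_def)
  have nb: "?y (i + 1) j = 0 \<and> ?y i (j + 1) = 0" if z: "?y i j = 0" for i j
  proof -
    have wz: "w k i j = 0" using ctl k z by (auto simp: controlled_def)
    have K: "w k i j \<in> coneK" for i j using ctl k by (auto simp: controlled_def)
    have "opB N w k i j \<le> 0"
    proof -
      have "opB N w k i j =
        (- w k (i - 1) j $ 1 + w k (i + 1) j $ 2 - w k i (j - 1) $ 3 + w k i (j + 1) $ 4) / mesh N"
        using wz by (simp add: opB_def D1_def D2_def add_divide_distrib diff_divide_distrib)
      moreover have "- w k (i - 1) j $ 1 + w k (i + 1) j $ 2 - w k i (j - 1) $ 3 + w k i (j + 1) $ 4 \<le> 0"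
        using K[of "i - 1" j] K[of "i + 1" j] K[of i "j - 1"] K[of i "j + 1"]
        by (simp add: coneK_def)
      ultimately show ?thesis
        using mesh_pos by (simp add: divide_le_0_iff)
    qed
    moreover have "m k i j / tstep T NT \<ge> 0"
      using m_nonneg tstep_pos by simp
    moreover have "- m k i j / tstep T NT - \<nu> * Lap N ?y i j + opB N w k i j = 0"
      using dynamicsD(5)[OF dyn k, of i j] z by (simp add: opA_def Dt_def)
    ultimately have "\<nu> * Lap N ?y i j \<le> 0" by simp
    then have "Lap N ?y i j \<le> 0"
      using nu by (simp add: mult_le_0_iff)
    moreover have "Lap N ?y i j =
        (?y (i + 1) j + ?y (i - 1) j + ?y i (j + 1) + ?y i (j - 1)) / (mesh N)\<^sup>2"
      using z by (simp add: Lap_def divide_inverse algebra_simps)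
    ultimately have "?y (i + 1) j + ?y (i - 1) j + ?y i (j + 1) + ?y i (j - 1) \<le> 0"
      using mesh_pos by (simp add: divide_le_0_iff)
    then show ?thesis
      using y_nonneg[of "i + 1" j] y_nonneg[of "i - 1" j] y_nonneg[of i "j + 1"]
        y_nonneg[of i "j - 1"] by linarith
  qed
  assume "\<not> ?y i j > 0"
  then have z: "?y i j = 0" using y_nonneg[of i j] by simp
  have z1: "?y (i + int a) j = 0" for a
  proof (induction a)
    case (Suc a)
    then show ?case using nb[of "i + int a" j] by (simp add: add_ac)
  qed (simp add: z)
  have z2: "?y (i + int a) (j + int b) = 0" for a b
  proof (induction b)
    case (Suc b)
    then show ?case using nb[of "i + int a" "j + int b"] by (simp add: add_ac)
  qed (simp add: z1)
  \<comment> \<open>Steps to the right and upwards suffice, since every residue class modulo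
    \<open>N\<close> is reached by adding a nonnegative number.\<close>
  have "?y a b = 0" for a b
  proof -
    have "(i + int (nat ((a - i) mod int N))) mod int N = a mod int N"
      "(j + int (nat ((b - j) mod int N))) mod int N = b mod int N"
      using N by (simp_all add: mod_add_right_eq)
    then show ?thesis
      using z2[of "nat ((a - i) mod int N)" "nat ((b - j) mod int N)"] gridfun_mod[OF y] by metis
  qed
  then have "gsum N ?y = 0" by (simp add: gsum_def)
  then show False using dynamics_mass[OF dyn, of "Suc k"] k mass_pos by simp
qed

lemma ereal_cost:
  assumes "\<And>k i j. k < NT \<Longrightarrow> m (Suc k) i j > 0 \<and> w k i j \<in> coneK"
  shows "costB q NT N m w + costF T NT N f g m = ereal (cost m w)"
proof -
  \<comment> \<open>The objective pairs \<open>m k\<close> with \<open>w (k - 1)\<close>; the index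
    shift turns this into \<open>m (Suc k)\<close> with \<open>w k\<close>.\<close>
  have r: "(\<Sum>k = Suc 0..NT. h k) = (\<Sum>k<NT. h (Suc k))" for h :: "nat \<Rightarrow> ereal"
    using sum.atLeast1_atMost_eq[of h NT] by simp
  have B: "costB q NT N m w =
      ereal (\<Sum>k<NT. gsum N (\<lambda>i j. norm (w k i j) powr q / (q * m (Suc k) i j powr (q - 1))))"
    using assms by (simp add: costB_def r bhat_def gsum_def del: sum.lessThan_Suc)
  have "m NT i j \<ge> 0" for i j
    using assms[of "NT - 1" i j] NT by simp
  moreover have "m (Suc k) i j \<ge> 0" if "k < NT" for k i j
    using assms[OF that, of i j] by simp
  ultimately have F: "costF T NT N f g m =
      ereal ((\<Sum>k<NT. gsum N (\<lambda>i j. integral {0..m (Suc k) i j} (f (gridpt N i j)))) +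
        1 / tstep T NT * gsum N (\<lambda>i j. integral {0..m NT i j} (g (gridpt N i j))))"
    by (simp add: costF_def r primitive_def gsum_def del: sum.lessThan_Suc)
  show ?thesis
    unfolding B F cost_def by (simp add: gsum_add sum.distrib)
qed

lemma finite_cost_controlled:
  assumes dyn: "dynamics m w" and fin: "costB q NT N m w + costF T NT N f g m \<noteq> \<infinity>"
  shows "controlled m w"
proof -
  \<comment> \<open>In \<open>ereal\<close> a summand \<open>\<infinity>\<close> makes the sum
    \<open>\<infinity>\<close>, even against \<open>-\<infinity>\<close>; the same fact then makes
    each summand of \<open>costB\<close> finite.\<close>
  have "costB q NT N m w \<noteq> \<infinity>" using fin by auto
  then have b: "bhat q (m k i j) (w (k - 1) i j) \<noteq> \<infinity>"
    if "k \<in> {1..NT}" "i \<in> {0..<int N}" "j \<in> {0..<int N}" for k i j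
    using that by (auto simp: costB_def sum_Pinfty)
  have "bhat q (m (Suc k) i j) (w k i j) \<noteq> \<infinity>" if "k < NT" for k i j
  proof (rule gridfun_everywhere[OF _ N])
    show "(\<lambda>i j. bhat q (m (Suc k) i j) (w k i j) \<noteq> \<infinity>) \<in> gridfun N"
      using dynamicsD[OF dyn] that
      by (intro gridfun_comp2[where F = "\<lambda>a b. bhat q a b \<noteq> \<infinity>"]) auto
  qed (use b[of "Suc k"] that in auto)
  then show ?thesis
    unfolding controlled_def using bhat_finiteD by blast
qed

end

subsection \<open>Existence of minimisers\<close>

lemma powr_le_imp_le_root:
  fixes a b p :: real
  assumes "a powr p \<le> b" "p > 0" "a \<ge> 0"
  shows "a \<le> b powr (1 / p)"
proof -
  have "a = (a powr p) powr (1 / p)"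
    using assms by (simp add: powr_powr)
  also have "\<dots> \<le> b powr (1 / p)"
    using assms by (intro powr_mono2) auto
  finally show ?thesis .
qed

lemma continuous_section:
  assumes "continuous_on UNIV (\<lambda>(x, s). \<phi> x s)"
  shows "continuous_on S (\<phi> x)"
proof -
  have "continuous_on S (\<lambda>s. (\<lambda>(x, s). \<phi> x s) (x, s))"
    by (rule continuous_on_compose2[OF assms]) (auto intro!: continuous_intros)
  then show ?thesis by simp
qed

lemma continuous_primitive:
  fixes \<phi> :: "'a::topological_space \<Rightarrow> real \<Rightarrow> real"
  assumes "continuous_on UNIV (\<lambda>(x, s). \<phi> x s)"
  shows "continuous_on {0..b} (\<lambda>s. integral {0..s} (\<phi> x))"
  by (intro indefinite_integral_continuous_1 integrable_continuous_interval
      continuous_section[OF assms])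

lemma bounded_primitive:
  fixes \<phi> :: "'a::topological_space \<Rightarrow> real \<Rightarrow> real"
  assumes "continuous_on UNIV (\<lambda>(x, s). \<phi> x s)"
  shows "\<exists>L. \<forall>s\<in>{0..b}. \<bar>integral {0..s} (\<phi> x)\<bar> \<le> L"
proof -
  have "bounded ((\<lambda>s. integral {0..s} (\<phi> x)) ` {0..b})"
    by (intro compact_imp_bounded compact_continuous_image continuous_primitive[OF assms]) simp
  then show ?thesis by (simp add: bounded_iff)
qed

text \<open>Tychonoff's theorem, transferred to the topology of the function type, so that
  infinitely many space-time indices do no harm.\<close>

lemma compact_PiE_UNIV:
  fixes K :: "'a \<Rightarrow> 'b::topological_space set"
  assumes "\<And>i. compact (K i)"
  shows "compact {z. \<forall>i. z i \<in> K i}"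
proof -
  have "compactin (product_topology (\<lambda>i. euclidean) UNIV) (PiE UNIV K)"
    using assms by (simp add: compactin_PiE)
  then show ?thesis
    by (simp add: euclidean_product_topology PiE_def Pi_def)
qed

context discrete_mfg
begin

lemma mass_bound:
  assumes "dynamics m w" "controlled m w" "k \<le> NT"
  shows "m k i j \<in> {0..gsum N mb}"
proof -
  have nonneg: "m k i j \<ge> 0" for i j
    using assms mb_nonneg dynamicsD(4)[OF assms(1)] by (cases k) (auto simp: controlled_def)
  have "m k (i mod int N) (j mod int N) \<le> gsum N (m k)"
    using N nonneg by (intro member_le_gsum) auto
  then show ?thesis
    using nonneg dynamics_mass[OF assms(1,3)] gridfun_mod[OF dynamicsD(1)[OF assms(1,3)], of i j]
    by simp
qed

text \<open>Pure diffusion with zero flux. This provides a finite cost level, hence a nonempty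
  sublevel set.\<close>

lemma reference_pair: "\<exists>m w. dynamics m w \<and> controlled m w"
proof (intro exI conjI)
  let ?m = "heat_flow N \<nu> (tstep T NT) (\<lambda>k i j. 0) mb" and ?w = "\<lambda>k i j. 0 :: real ^ 4"
  have z: "(\<lambda>i j. 0 :: real) \<in> gridfun N" by (rule gridfun_const)
  show "dynamics ?m ?w"
    unfolding dynamics_def
  proof (intro conjI allI impI)
    fix k i j
    show "opA \<nu> T NT N ?m k i j + opB N ?w k i j = 0"
      using heat_flow_eq[OF mb_grid z N, of \<nu> "tstep T NT" k i j] nu tstep_pos
      by (simp add: opA_def Dt_def opB_def D1_def D2_def del: heat_flow.simps(2))
  qed (simp_all add: gridfun_heat_flow[OF mb_grid z] gridfun_const)
  show "controlled ?m ?w"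
    unfolding controlled_def
    using heat_flow_nonneg[OF mb_grid z N, of \<nu> "tstep T NT"] mb_nonneg nu tstep_pos
    by (auto simp: coneK_def simp del: heat_flow.simps(2))
qed

text \<open>Coercivity: densities stay between 0 and the total mass, so the potential terms are
  bounded by a constant \<open>c\<close> depending only on the data, and each nonnegative kinetic
  term is at most \<open>cost m w + c\<close>. Multiplying out the denominator gives a condition
  that remains closed where the density vanishes.\<close>

lemma kinetic_bound:
  "\<exists>c. \<forall>m w k i j. dynamics m w \<and> controlled m w \<and> k < NT \<longrightarrow>
     norm (w k i j) powr q \<le> q * (cost m w + c) * m (Suc k) i j powr (q - 1)"
proof -
  let ?M = "gsum N mb"
  obtain Lf where Lf: "\<And>x s. s \<in> {0..?M} \<Longrightarrow> \<bar>integral {0..s} (f x)\<bar> \<le> Lf x"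
    using bounded_primitive[OF f_cont] by metis
  obtain Lg where Lg: "\<And>x s. s \<in> {0..?M} \<Longrightarrow> \<bar>integral {0..s} (g x)\<bar> \<le> Lg x"
    using bounded_primitive[OF g_cont] by metis
  define c where "c = (\<Sum>k<NT. gsum N (\<lambda>i j. Lf (gridpt N i j)))
    + 1 / tstep T NT * gsum N (\<lambda>i j. Lg (gridpt N i j))"
  have gsum_mono: "gsum N y \<le> gsum N z" if "\<And>i j. y i j \<le> z i j" for y z
    using that by (auto simp: gsum_def intro!: sum_mono)
  have "norm (w k i j) powr q \<le> q * (cost m w + c) * m (Suc k) i j powr (q - 1)"
    if dyn: "dynamics m w" and ctl: "controlled m w" and k: "k < NT" for m w k i j
  proof -
    define b where "b k i j = norm (w k i j) powr q / (q * m (Suc k) i j powr (q - 1))" for k i j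
    have b_nonneg: "b k i j \<ge> 0" for k i j
      using q by (simp add: b_def)
    have b_le: "b k i' j' \<le> (\<Sum>k<NT. gsum N (b k))"
      if "i' \<in> {0..<int N}" "j' \<in> {0..<int N}" for i' j'
    proof -
      have "b k i' j' \<le> gsum N (b k)"
        using that b_nonneg by (intro member_le_gsum)
      also have "\<dots> \<le> (\<Sum>k<NT. gsum N (b k))"
        using k b_nonneg by (intro member_le_sum) (auto simp: gsum_def intro!: sum_nonneg)
      finally show ?thesis .
    qed
    have "b k i j \<le> (\<Sum>k<NT. gsum N (b k))"
    proof (rule gridfun_everywhere[where P = "\<lambda>i j. b k i j \<le> (\<Sum>k<NT. gsum N (b k))", OF _ N])
      show "(\<lambda>i j. b k i j \<le> (\<Sum>k<NT. gsum N (b k))) \<in> gridfun N"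
        unfolding gridfun_def b_def
        using gridfunD[OF dynamicsD(2)[OF dyn k]] gridfunD[OF dynamicsD(3)[OF dyn k]] by simp
    qed (rule b_le)
    also have "\<dots> \<le> cost m w + c"
    proof -
      have "(\<Sum>k<NT. gsum N (\<lambda>i j. - integral {0..m (Suc k) i j} (f (gridpt N i j))))
          \<le> (\<Sum>k<NT. gsum N (\<lambda>i j. Lf (gridpt N i j)))"
      proof (intro sum_mono gsum_mono)
        fix k i j assume "k \<in> {..<NT}"
        then show "- integral {0..m (Suc k) i j} (f (gridpt N i j)) \<le> Lf (gridpt N i j)"
          using Lf[OF mass_bound[OF dyn ctl, of "Suc k" i j], of "gridpt N i j"] by auto
      qed
      moreover have "1 / tstep T NT * gsum N (\<lambda>i j. - integral {0..m NT i j} (g (gridpt N i j)))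
          \<le> 1 / tstep T NT * gsum N (\<lambda>i j. Lg (gridpt N i j))"
      proof (intro mult_left_mono gsum_mono)
        fix i j
        show "- integral {0..m NT i j} (g (gridpt N i j)) \<le> Lg (gridpt N i j)"
          using Lg[OF mass_bound[OF dyn ctl, of NT i j], of "gridpt N i j"] by auto
      qed (use tstep_pos in simp)
      moreover have "cost m w = (\<Sum>k<NT. gsum N (b k))
         - (\<Sum>k<NT. gsum N (\<lambda>i j. - integral {0..m (Suc k) i j} (f (gridpt N i j))))
         - 1 / tstep T NT * gsum N (\<lambda>i j. - integral {0..m NT i j} (g (gridpt N i j)))"
        by (simp add: cost_def b_def[abs_def] gsum_def sum.distrib sum_negf)
      ultimately show ?thesis by (simp add: c_def)
    qed
    finally have "b k i j \<le> cost m w + c" .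
    moreover have "m (Suc k) i j powr (q - 1) > 0"
      using dynamics_positive[OF dyn ctl k, of i j] by simp
    ultimately show ?thesis
      using q by (simp add: b_def field_simps)
  qed
  then show ?thesis by blast
qed

text \<open>Pairs \<open>(m, w)\<close> are coded as single functions on the space-time indices, so that Tychonoff's
  theorem yields compactness. The absolute value in \<open>sublevel\<close> makes the constraint continuous on the
  whole function space; it is redundant on the box.\<close>

definition mz :: "(nat \<times> int \<times> int \<Rightarrow> real \<times> (real ^ 4)) \<Rightarrow> nat \<Rightarrow> int \<Rightarrow> int \<Rightarrow> real" where
  "mz z k i j = fst (z (k, i, j))"

definition wz :: "(nat \<times> int \<times> int \<Rightarrow> real \<times> (real ^ 4)) \<Rightarrow> nat \<Rightarrow> int \<Rightarrow> int \<Rightarrow> real ^ 4" where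
  "wz z k i j = snd (z (k, i, j))"

lemma continuous_mz [continuous_intros]: "continuous_on UNIV (\<lambda>z. mz z k i j)"
  unfolding mz_def by (intro continuous_on_fst continuous_on_product_coordinates)

lemma continuous_wz [continuous_intros]: "continuous_on UNIV (\<lambda>z. wz z k i j)"
  unfolding wz_def by (intro continuous_on_snd continuous_on_product_coordinates)

lemma closed_dynamics: "closed {z. dynamics (mz z) (wz z)}"
proof -
  have imp: "closed {z. P \<longrightarrow> Q z}" if "closed {z. Q z}" for P and Q :: "_ \<Rightarrow> bool"
    using that by (cases P) auto
  show ?thesis
    unfolding dynamics_def gridfun_def mem_Collect_eq fun_eq_iff[of "mz _ 0"]
      opA_def opB_def Dt_def Lap_def D1_def D2_def
    using tstep_pos mesh_pos
    by (intro closed_Collect_conj closed_Collect_all imp closed_Collect_eq continuous_intros) auto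
qed

definition sublevel where
  "sublevel C R = {z. \<forall>p. z p \<in> {0..gsum N mb} \<times> cball 0 R} \<inter> {z. dynamics (mz z) (wz z)} \<inter>
     {z. \<forall>k i j. k < NT \<longrightarrow> wz z k i j \<in> coneK \<and>
        norm (wz z k i j) powr q \<le> C * \<bar>mz z (Suc k) i j\<bar> powr (q - 1)}"

lemma compact_sublevel: "compact (sublevel C R)"
proof -
  have imp: "closed {z. P \<longrightarrow> Q z}" if "closed {z. Q z}" for P and Q :: "_ \<Rightarrow> bool"
    using that by (cases P) auto
  have "closed {z. \<forall>k i j. k < NT \<longrightarrow> wz z k i j \<in> coneK \<and>
      norm (wz z k i j) powr q \<le> C * \<bar>mz z (Suc k) i j\<bar> powr (q - 1)}"
    unfolding coneK_def mem_Collect_eq using q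
    by (intro closed_Collect_conj closed_Collect_all imp closed_Collect_le continuous_intros
        continuous_on_powr') auto
  moreover have "compact {z :: nat \<times> int \<times> int \<Rightarrow> real \<times> (real ^ 4).
      \<forall>p. z p \<in> {0..gsum N mb} \<times> cball 0 R}"
    by (intro compact_PiE_UNIV compact_Times) auto
  ultimately show ?thesis
    unfolding sublevel_def by (intro compact_Int_closed closed_dynamics)
qed

text \<open>The power inequality is the closed substitute for "no flux where there is no mass": at
  density 0 its right-hand side is \<open>C * 0 powr (q - 1) = 0\<close>.\<close>

lemma sublevel_controlled:
  assumes "z \<in> sublevel C R"
  shows "dynamics (mz z) (wz z)" "controlled (mz z) (wz z)"
proof -
  show "dynamics (mz z) (wz z)" using assms by (simp add: sublevel_def)
  have z: "z p \<in> {0..gsum N mb} \<times> cball 0 R" for p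
    using assms by (simp add: sublevel_def del: split_paired_All)
  have "mz z k i j \<ge> 0" for k i j
    using z[of "(k, i, j)"] by (auto simp: mz_def mem_Times_iff)
  moreover have "wz z k i j = 0" if "k < NT" "mz z (Suc k) i j = 0" for k i j
  proof -
    have "norm (wz z k i j) powr q \<le> C * \<bar>mz z (Suc k) i j\<bar> powr (q - 1)"
      using assms that unfolding sublevel_def by blast
    then show ?thesis
      using that by simp
  qed
  ultimately show "controlled (mz z) (wz z)"
    using assms by (auto simp: controlled_def sublevel_def)
qed

lemma continuous_cost: "continuous_on (sublevel C R) (\<lambda>z. cost (mz z) (wz z))"
proof -
  have m: "continuous_on (sublevel C R) (\<lambda>z. mz z k i j)" for k i j
    by (rule continuous_on_subset[OF continuous_mz]) simp
  have w: "continuous_on (sublevel C R) (\<lambda>z. wz z k i j)" for k i j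
    by (rule continuous_on_subset[OF continuous_wz]) simp
  have pos: "mz z (Suc k) i j > 0" if "z \<in> sublevel C R" "k < NT" for z k i j
    using dynamics_positive[OF sublevel_controlled[OF that(1)] that(2)] .
  have prim: "continuous_on (sublevel C R) (\<lambda>z. integral {0..mz z k i j} (\<phi> x))"
    if "continuous_on UNIV (\<lambda>(x, s). \<phi> x s)"
    for \<phi> :: "real \<times> real \<Rightarrow> real \<Rightarrow> real" and x k i j
  proof (rule continuous_on_compose2[OF continuous_primitive[OF that] m])
    show "(\<lambda>z. mz z k i j) ` sublevel C R \<subseteq> {0..gsum N mb}"
      by (force simp: sublevel_def mz_def mem_Times_iff)
  qed
  have kin: "continuous_on (sublevel C R)
      (\<lambda>z. norm (wz z k i j) powr q / (q * mz z (Suc k) i j powr (q - 1)))" if "k < NT" for k i j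
  proof (rule continuous_on_divide)
    show "continuous_on (sublevel C R) (\<lambda>z. norm (wz z k i j) powr q)"
      by (rule continuous_on_powr') (use q in \<open>auto intro!: continuous_intros w\<close>)
    have "continuous_on (sublevel C R) (\<lambda>z. mz z (Suc k) i j powr (q - 1))"
      by (rule continuous_on_powr')
        (use q pos[OF _ that] in \<open>auto intro!: continuous_intros m less_imp_le\<close>)
    then show "continuous_on (sublevel C R) (\<lambda>z. q * mz z (Suc k) i j powr (q - 1))"
      by (rule continuous_on_mult_left)
    show "\<forall>z\<in>sublevel C R. q * mz z (Suc k) i j powr (q - 1) \<noteq> 0"
      using q pos[OF _ that, of _ i j] by force
  qed
  show ?thesis
    unfolding cost_def gsum_def
    by (intro continuous_intros kin prim f_cont g_cont) auto
qed

lemma minimizer_exists: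
  "\<exists>m w. dynamics m w \<and> controlled m w \<and>
     (\<forall>m' w'. dynamics m' w' \<and> controlled m' w' \<longrightarrow> cost m w \<le> cost m' w')"
proof -
  obtain m0 w0 where ref: "dynamics m0 w0" "controlled m0 w0"
    using reference_pair by blast
  obtain c where c: "\<And>m w k i j. dynamics m w \<Longrightarrow> controlled m w \<Longrightarrow> k < NT \<Longrightarrow>
     norm (w k i j) powr q \<le> q * (cost m w + c) * m (Suc k) i j powr (q - 1)"
    using kinetic_bound by blast
  \<comment> \<open>\<open>C\<close> is the coercivity constant at the cost level of the reference
    pair, with an absolute value to make its sign evident; \<open>R\<close> then follows from
    bounding the density by the mass.\<close>
  define C where "C = \<bar>q * (cost m0 w0 + c)\<bar>"
  define R where "R = (C * gsum N mb powr (q - 1)) powr (1 / q)"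
  \<comment> \<open>Coordinates at inadmissible times are set to 0, which keeps them inside the
    compact box.\<close>
  define enc where "enc m w = (\<lambda>(k, i, j). (if k \<le> NT then m k i j else 0,
    if k < NT then w k i j else 0))" for m :: "nat \<Rightarrow> int \<Rightarrow> int \<Rightarrow> real"
    and w :: "nat \<Rightarrow> int \<Rightarrow> int \<Rightarrow> real ^ 4"
  have mz_enc: "k \<le> NT \<Longrightarrow> mz (enc m w) k = m k" and wz_enc: "k < NT \<Longrightarrow> wz (enc m w) k = w k"
    for m w k
    by (auto simp: mz_def wz_def enc_def fun_eq_iff)
  have enc: "enc m w \<in> sublevel C R"
    if dyn: "dynamics m w" and ctl: "controlled m w" and le: "cost m w \<le> cost m0 w0" for m w
  proof -
    have b: "norm (w k i j) powr q \<le> C * m (Suc k) i j powr (q - 1)" if "k < NT" for k i j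
    proof -
      have "q * (cost m w + c) \<le> C"
        unfolding C_def using le q by (intro order_trans[OF _ abs_ge_self] mult_left_mono) auto
      then show ?thesis
        using c[OF dyn ctl that, of i j] by (meson mult_right_mono order_trans powr_ge_zero)
    qed
    have r: "norm (w k i j) \<le> R" if "k < NT" for k i j
      unfolding R_def
    proof (rule powr_le_imp_le_root)
      have "m (Suc k) i j powr (q - 1) \<le> gsum N mb powr (q - 1)"
        using mass_bound[OF dyn ctl, of "Suc k" i j] that q by (intro powr_mono2) auto
      then show "norm (w k i j) powr q \<le> C * gsum N mb powr (q - 1)"
        using b[OF that, of i j] by (smt (verit) C_def mult_left_mono)
    qed (use q in auto)
    have "dynamics (mz (enc m w)) (wz (enc m w))"
      using dyn by (subst dynamics_cong[of _ m _ w]) (auto simp: mz_enc wz_enc)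
    moreover have "enc m w (k, i, j) \<in> {0..gsum N mb} \<times> cball 0 R" for k i j
      using mass_bound[OF dyn ctl, of k i j] r[of k i j] mass_pos by (auto simp: enc_def R_def)
    moreover have "wz (enc m w) k i j \<in> coneK \<and>
        norm (wz (enc m w) k i j) powr q \<le> C * \<bar>mz (enc m w) (Suc k) i j\<bar> powr (q - 1)"
      if "k < NT" for k i j
      using b[OF that, of i j] ctl that by (auto simp: controlled_def mz_enc wz_enc)
    ultimately show ?thesis by (auto simp: sublevel_def)
  qed
  have cost_enc: "cost (mz (enc m w)) (wz (enc m w)) = cost m w" for m w
    by (rule cost_cong) (auto simp: mz_enc wz_enc)
  have "sublevel C R \<noteq> {}" using enc[OF ref] by auto
  then obtain z where z: "z \<in> sublevel C R"
    and min: "\<And>z'. z' \<in> sublevel C R \<Longrightarrow> cost (mz z) (wz z) \<le> cost (mz z') (wz z')"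
    using continuous_attains_inf[OF compact_sublevel _ continuous_cost] by blast
  \<comment> \<open>A competitor above the reference level may lie outside the sublevel set, but the
    minimiser already beats the reference pair.\<close>
  have "cost (mz z) (wz z) \<le> cost m w" if "dynamics m w" "controlled m w" for m w
    using min[OF enc[OF ref]] min[OF enc[OF that]] by (cases "cost m w \<le> cost m0 w0") (auto simp: cost_enc)
  then show ?thesis
    using sublevel_controlled[OF z] by blast
qed

section \<open>Return from the real-valued cost to the extended-valued problem\<close>

lemma feasible_cost_real:
  assumes "dynamics m w" "controlled m w"
  shows "costB q NT N m w + costF T NT N f g m = ereal (cost m w)"
  using dynamics_positive[OF assms] assms(2) by (intro ereal_cost) (auto simp: controlled_def)

text \<open>Competitors of infinite cost lose trivially; finite cost makes a feasible pair
  \<open>controlled\<close>, and then its extended cost is the real one.\<close>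

lemma solution_exists: "\<exists>m w. is_solution q \<nu> T NT N f g mb m w"
proof -
  obtain m w where dyn: "dynamics m w" and ctl: "controlled m w"
    and min: "\<And>m' w'. dynamics m' w' \<Longrightarrow> controlled m' w' \<Longrightarrow> cost m w \<le> cost m' w'"
    using minimizer_exists by blast
  let ?m = "restrict m {0..NT}" and ?w = "restrict w {0..<NT}"
  have feas: "(?m, ?w) \<in> feasible \<nu> T NT N mb"
    by (rule dynamics_feasible[OF dyn])
  have "controlled ?m ?w"
    using ctl by (subst controlled_cong[of _ m _ w]) auto
  moreover have "cost ?m ?w = cost m w"
    by (rule cost_cong) auto
  ultimately have c: "costB q NT N ?m ?w + costF T NT N f g ?m = ereal (cost m w)"
    using feasible_cost_real[OF feasible_dynamics[OF feas]] by simp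
  have "ereal (cost m w) \<le> costB q NT N m' w' + costF T NT N f g m'"
    if feas': "(m', w') \<in> feasible \<nu> T NT N mb" for m' w'
  proof (cases "costB q NT N m' w' + costF T NT N f g m' = \<infinity>")
    case False
    note dyn' = feasible_dynamics[OF feas']
    have "controlled m' w'" by (rule finite_cost_controlled[OF dyn' False])
    then show ?thesis
      using min[OF dyn'] feasible_cost_real[OF dyn'] by simp
  qed (simp only: ereal_less_eq)
  then have "ereal (cost m w) =
      (INF (m', w') \<in> feasible \<nu> T NT N mb. costB q NT N m' w' + costF T NT N f g m')"
    using feas c by (intro antisym INF_greatest INF_lower2[of "(?m, ?w)"]) auto
  moreover have "\<bar>costB q NT N ?m ?w + costF T NT N f g ?m\<bar> \<noteq> \<infinity>"
    unfolding c by simp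
  ultimately have "is_solution q \<nu> T NT N f g mb ?m ?w"
    using feas c unfolding is_solution_def by metis
  then show ?thesis by blast
qed

text \<open>Concerns an arbitrary solution rather than the one constructed above, because the system
  and the positivity are claimed for each of them.\<close>

lemma solution_minimal:
  assumes sol: "is_solution q \<nu> T NT N f g mb m w"
  shows "dynamics m w" "controlled m w"
    "dynamics m' w' \<Longrightarrow> controlled m' w' \<Longrightarrow> cost m w \<le> cost m' w'"
proof -
  show dyn: "dynamics m w"
    using sol by (auto simp: is_solution_def intro: feasible_dynamics)
  show ctl: "controlled m w"
    using sol by (intro finite_cost_controlled[OF dyn]) (auto simp: is_solution_def)
  assume dyn': "dynamics m' w'" and ctl': "controlled m' w'"
  let ?m = "restrict m' {0..NT}" and ?w = "restrict w' {0..<NT}"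
  have feas: "(?m, ?w) \<in> feasible \<nu> T NT N mb"
    by (rule dynamics_feasible[OF dyn'])
  have "controlled ?m ?w"
    using ctl' by (subst controlled_cong[of _ m' _ w']) auto
  moreover have "cost ?m ?w = cost m' w'"
    by (rule cost_cong) auto
  ultimately have c: "costB q NT N ?m ?w + costF T NT N f g ?m = ereal (cost m' w')"
    using feasible_cost_real[OF feasible_dynamics[OF feas]] by simp
  have "ereal (cost m w) \<le> ereal (cost m' w')"
    using sol feas c feasible_cost_real[OF dyn ctl]
    by (auto simp: is_solution_def intro: INF_lower2[of "(?m, ?w)"])
  then show "cost m w \<le> cost m' w'" by simp
qed

end

subsection \<open>Optimality conditions\<close>

text \<open>At \<open>w = 0\<close> the difference quotient has size
  \<open>|t|^(q - 1) |v|^q\<close> and tends to 0 because \<open>q > 1\<close>; the formula also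
  gives 0 there, as the inner product vanishes, even for \<open>q < 2\<close>.\<close>

lemma norm_powr_has_real_derivative:
  fixes w v :: "'a::real_inner"
  assumes "q > 1"
  shows "((\<lambda>t. norm (w + t *\<^sub>R v) powr q) has_real_derivative
    q * norm w powr (q - 2) * (w \<bullet> v)) (at 0)"
proof (cases "w = 0")
  case True
  have "isCont (\<lambda>t::real. \<bar>t\<bar> powr (q - 1) * norm v powr q) 0"
  proof -
    have "continuous_on UNIV (\<lambda>t::real. \<bar>t\<bar> powr (q - 1))"
      by (rule continuous_on_powr') (use assms in \<open>auto intro!: continuous_intros\<close>)
    then have "isCont (\<lambda>t::real. \<bar>t\<bar> powr (q - 1)) 0"
      using continuous_on_eq_continuous_at open_UNIV by blast
    then show ?thesis
      by (intro isCont_mult continuous_const)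
  qed
  then have "((\<lambda>t::real. \<bar>t\<bar> powr (q - 1) * norm v powr q) \<longlongrightarrow> 0) (at 0)"
    by (simp add: isCont_def)
  moreover have "\<bar>norm (h *\<^sub>R v) powr q / h\<bar> = \<bar>h\<bar> powr (q - 1) * norm v powr q" for h
    using assms by (cases "h = 0") (simp_all add: powr_mult powr_diff)
  ultimately have "((\<lambda>h. \<bar>norm (h *\<^sub>R v) powr q / h\<bar>) \<longlongrightarrow> 0) (at 0)"
    by simp
  then have "((\<lambda>h. norm (h *\<^sub>R v) powr q / h) \<longlongrightarrow> 0) (at 0)"
    by (rule tendsto_rabs_zero_cancel)
  then show ?thesis
    using True by (simp add: has_field_derivative_iff)
next
  case False
  have n: "((\<lambda>t. norm (w + t *\<^sub>R v)) has_real_derivative (w \<bullet> v) / norm w) (at 0)"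
  proof -
    have "((\<lambda>t. sqrt ((w \<bullet> w) + 2 * t * (w \<bullet> v) + t\<^sup>2 * (v \<bullet> v))) has_real_derivative
       (2 * (w \<bullet> v)) / (2 * sqrt (w \<bullet> w))) (at 0)"
      using False
      by (auto intro!: derivative_eq_intros simp: field_simps) (meson inner_ge_zero not_less)
    then show ?thesis
      by (simp add: norm_eq_sqrt_inner inner_add inner_commute algebra_simps power2_eq_square)
  qed
  have "((\<lambda>x. x powr q) has_real_derivative q * norm w powr (q - 1)) (at (norm w))"
    using False by (intro has_real_derivative_powr) simp
  then have "((\<lambda>t. norm (w + t *\<^sub>R v) powr q) has_real_derivative
      q * norm w powr (q - 1) * ((w \<bullet> v) / norm w)) (at 0)"
    using DERIV_chain2[OF _ n, of "\<lambda>x. x powr q"] by simp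
  moreover have "norm w powr (q - 1) = norm w powr (q - 2) * norm w"
    using powr_mult_base[of "norm w" "q - 2"] by (simp add: mult.commute)
  ultimately show ?thesis using False by (simp add: mult.assoc)
qed

text \<open>The coefficient of \<open>\<mu>\<close> is the origin of the Hamiltonian:
  \<open>(q - 1) / q\<close> is \<open>1 / q'\<close>, and \<open>|w|^q / m^q\<close> later turns
  into \<open>|hatD u|^q'\<close>.\<close>

lemma kinetic_has_real_derivative:
  fixes w v :: "'a::real_inner"
  assumes "q > 1" "m > 0"
  shows "((\<lambda>t. norm (w + t *\<^sub>R v) powr q / (q * (m + t * \<mu>) powr (q - 1))) has_real_derivative
    norm w powr (q - 2) / m powr (q - 1) * (w \<bullet> v)
      - (q - 1) / q * (norm w powr q / m powr q) * \<mu>) (at 0)"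
proof -
  have p: "((\<lambda>t. (m + t * \<mu>) powr (q - 1)) has_real_derivative (q - 1) * m powr (q - 2) * \<mu>) (at 0)"
  proof (rule DERIV_chain2[of "\<lambda>x. x powr (q - 1)"])
    show "((\<lambda>x. x powr (q - 1)) has_real_derivative (q - 1) * m powr (q - 2)) (at (m + 0 * \<mu>))"
      using has_real_derivative_powr[OF assms(2), of "q - 1"] by simp
    show "((\<lambda>t. m + t * \<mu>) has_real_derivative \<mu>) (at 0)"
      by (auto intro!: derivative_eq_intros)
  qed
  have m: "m powr (q - 2) * m powr q = m powr (q - 1) * m powr (q - 1)"
    by (simp flip: powr_add)
  have "((\<lambda>t. norm (w + t *\<^sub>R v) powr q / (q * (m + t * \<mu>) powr (q - 1))) has_real_derivative
    (q * norm w powr (q - 2) * (w \<bullet> v) * (q * m powr (q - 1))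
      - norm w powr q * (q * ((q - 1) * m powr (q - 2) * \<mu>)))
      / ((q * m powr (q - 1)) * (q * m powr (q - 1)))) (at 0)"
    using DERIV_divide[OF norm_powr_has_real_derivative[OF assms(1), of w v] DERIV_cmult[OF p, of q]]
      assms by simp
  moreover have "(q * norm w powr (q - 2) * (w \<bullet> v) * (q * m powr (q - 1))
      - norm w powr q * (q * ((q - 1) * m powr (q - 2) * \<mu>)))
      / ((q * m powr (q - 1)) * (q * m powr (q - 1))) =
    norm w powr (q - 2) / m powr (q - 1) * (w \<bullet> v)
      - (q - 1) / q * (norm w powr q / m powr q) * \<mu>"
  proof -
    have e1: "m powr (q - 2) / (m powr (q - 1) * m powr (q - 1)) = 1 / m powr q"
      using m assms by (simp add: field_simps)
    have e2: "(q * a * b * (q * c) - n * (q * ((q - 1) * d * \<mu>))) / ((q * c) * (q * c)) =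
        a / c * b - (q - 1) / q * n * (d / (c * c)) * \<mu>" if "c \<noteq> 0" for a b c d n
      using that assms by (simp add: field_simps)
    have c: "m powr (q - 1) \<noteq> 0" using assms by simp
    show ?thesis unfolding e2[OF c] e1 by simp
  qed
  ultimately show ?thesis by simp
qed

lemma primitive_has_real_derivative:
  fixes \<phi> :: "real \<Rightarrow> real"
  assumes "continuous_on UNIV \<phi>" "m > 0"
  shows "((\<lambda>t. integral {0..m + t * \<mu>} \<phi>) has_real_derivative \<phi> m * \<mu>) (at 0)"
proof -
  \<comment> \<open>The right end \<open>m + 1\<close> makes \<open>m\<close> an interior point, so
    that the derivative within the interval is a full one.\<close>
  have "((\<lambda>s. integral {0..s} \<phi>) has_real_derivative \<phi> m) (at m within {0..m + 1})"
    using assms by (intro integral_has_real_derivative continuous_on_subset[OF assms(1)]) auto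
  then have "((\<lambda>s. integral {0..s} \<phi>) has_real_derivative \<phi> m) (at m)"
    using assms by (simp add: at_within_Icc_at)
  moreover have "((\<lambda>t. m + t * \<mu>) has_real_derivative \<mu>) (at 0)"
    by (auto intro!: derivative_eq_intros)
  ultimately show ?thesis
    using DERIV_chain2[of "\<lambda>s. integral {0..s} \<phi>" "\<phi> m" "\<lambda>t. m + t * \<mu>" 0 \<mu>] by simp
qed

section \<open>Projection onto the sign cone\<close>

lemma halfline_projection:
  fixes l a v :: real
  assumes "l \<ge> 0" "a \<ge> 0" and var: "\<And>x. x \<ge> 0 \<Longrightarrow> (l * a - v) * (x - a) \<ge> 0"
  shows "l * a = max v 0"
proof (cases "a = 0")
  case True
  then show ?thesis using var[of 1] by simp
next
  case False
  have "l * a - v \<ge> 0" using var[of "a + 1"] assms by simp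
  moreover have "(l * a - v) * a \<le> 0" using var[of 0] by simp
  ultimately have "l * a = v" using False assms by (simp add: mult_le_0_iff)
  then show ?thesis using assms by (metis max.absorb1 mult_nonneg_nonneg)
qed

text \<open>\<open>coneK\<close> is a product of half-lines, so test vectors changed in one
  coordinate decouple the inequality. On \<open>[0, \<infinity>)\<close> the residual then vanishes
  in the interior and is nonnegative at the end point; coordinates 2 and 4 follow by
  reflection.\<close>

lemma coneK_projection:
  fixes v w :: "real ^ 4"
  assumes l: "l \<ge> 0" and w: "w \<in> coneK"
    and var: "\<And>\<kappa>. \<kappa> \<in> coneK \<Longrightarrow> (l *\<^sub>R w - v) \<bullet> (\<kappa> - w) \<ge> 0"
  shows "l *\<^sub>R w = vector [max (v $ 1) 0, min (v $ 2) 0, max (v $ 3) 0, min (v $ 4) 0]"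
proof -
  have ax: "(l * w $ a - v $ a) * (x - w $ a) \<ge> 0" if "w + axis a (x - w $ a) \<in> coneK" for a x
    using var[OF that] by (simp add: inner_axis)
  have "l * w $ a = max (v $ a) 0" if "a = 1 \<or> a = 3" for a
  proof (rule halfline_projection[OF l])
    show "w $ a \<ge> 0" using w that by (auto simp: coneK_def)
    show "(l * w $ a - v $ a) * (x - w $ a) \<ge> 0" if "x \<ge> 0" for x
      using w that \<open>a = 1 \<or> a = 3\<close> by (intro ax) (auto simp: coneK_def axis_def)
  qed
  moreover have "l * w $ a = min (v $ a) 0" if "a = 2 \<or> a = 4" for a
  proof -
    have "l * (- w $ a) = max (- v $ a) 0"
    proof (rule halfline_projection[OF l])
      show "- w $ a \<ge> 0" using w that by (auto simp: coneK_def)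
      show "(l * (- w $ a) - (- v $ a)) * (x - (- w $ a)) \<ge> 0" if "x \<ge> 0" for x
      proof -
        have "(l * w $ a - v $ a) * (- x - w $ a) \<ge> 0"
          using w that \<open>a = 2 \<or> a = 4\<close> by (intro ax) (auto simp: coneK_def axis_def)
        then show ?thesis by (simp add: algebra_simps)
      qed
    qed
    then show ?thesis by simp
  qed
  ultimately show ?thesis
    by (simp add: vec_eq_iff forall_4)
qed

section \<open>First variation and the adjoint state\<close>

lemma opA_perturb:
  "opA \<nu> T NT N (\<lambda>k i j. m k i j + t * \<mu> k i j) k i j = opA \<nu> T NT N m k i j + t * opA \<nu> T NT N \<mu> k i j"
  by (simp add: opA_def Dt_def Lap_def add_divide_distrib diff_divide_distrib algebra_simps)

lemma opB_perturb:
  "opB N (\<lambda>k i j. w k i j + t *\<^sub>R \<omega> k i j) k i j = opB N w k i j + t * opB N \<omega> k i j"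
  by (simp add: opB_def D1_def D2_def add_divide_distrib diff_divide_distrib algebra_simps)

lemma gridpt_periodic:
  assumes "torus_periodic \<phi>" "N > 0"
  shows "(\<lambda>i j. \<phi> (gridpt N i j)) \<in> gridfun N"
proof -
  have "(of_int i + real N) * mesh N = of_int i * mesh N + 1" for i
    using assms(2) by (simp add: mesh_def add_divide_distrib)
  then show ?thesis
    using assms(1) by (simp add: gridfun_def gridpt_def torus_periodic_def)
qed

context discrete_mfg
begin

text \<open>The segment towards \<open>(m + \<mu>, w + \<omega>)\<close> keeps the linear constraint
  for every \<open>t\<close>, but the cone only for \<open>t\<close> in \<open>[0, 1]\<close> and
  positivity only for small \<open>t\<close>. Hence a two-sided derivative yields just an
  inequality.\<close>

lemma first_variation:
  assumes dyn: "dynamics m w" and ctl: "controlled m w"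
    and min: "\<And>m' w'. dynamics m' w' \<Longrightarrow> controlled m' w' \<Longrightarrow> cost m w \<le> cost m' w'"
    and \<mu>: "\<And>k. \<mu> k \<in> gridfun N" "\<mu> 0 = (\<lambda>i j. 0)"
    and \<omega>: "\<And>k. \<omega> k \<in> gridfun N" "\<And>k i j. k < NT \<Longrightarrow> w k i j + \<omega> k i j \<in> coneK"
    and lin: "\<And>k i j. k < NT \<Longrightarrow> opA \<nu> T NT N \<mu> k i j + opB N \<omega> k i j = 0"
  shows "(\<Sum>k<NT. gsum N (\<lambda>i j.
      norm (w k i j) powr (q - 2) / m (Suc k) i j powr (q - 1) * (w k i j \<bullet> \<omega> k i j)
      + (f (gridpt N i j) (m (Suc k) i j)
         - (q - 1) / q * (norm (w k i j) powr q / m (Suc k) i j powr q)) * \<mu> (Suc k) i j))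
    + 1 / tstep T NT * gsum N (\<lambda>i j. g (gridpt N i j) (m NT i j) * \<mu> NT i j) \<ge> 0" (is "?D \<ge> 0")
proof (rule ccontr)
  assume neg: "\<not> ?D \<ge> 0"
  define mt where "mt t = (\<lambda>k i j. m k i j + t * \<mu> k i j)" for t
  define wt where "wt t = (\<lambda>k i j. w k i j + t *\<^sub>R \<omega> k i j)" for t
  have pos: "m (Suc k) i j > 0" if "k < NT" for k i j
    by (rule dynamics_positive[OF dyn ctl that])
  have pos_NT: "m NT i j > 0" for i j
    using pos[of "NT - 1" i j] NT by simp
  have cont: "continuous_on UNIV (f x)" "continuous_on UNIV (g x)" for x
    using continuous_section f_cont g_cont by blast+
  have stage: "((\<lambda>t. norm (w k i j + t *\<^sub>R \<omega> k i j) powr q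
        / (q * (m (Suc k) i j + t * \<mu> (Suc k) i j) powr (q - 1))
      + integral {0..m (Suc k) i j + t * \<mu> (Suc k) i j} (f (gridpt N i j))) has_real_derivative
    norm (w k i j) powr (q - 2) / m (Suc k) i j powr (q - 1) * (w k i j \<bullet> \<omega> k i j)
    + (f (gridpt N i j) (m (Suc k) i j)
       - (q - 1) / q * (norm (w k i j) powr q / m (Suc k) i j powr q)) * \<mu> (Suc k) i j) (at 0)"
    if "k < NT" for k i j
    using DERIV_add[OF kinetic_has_real_derivative[OF q pos[OF that, of i j],
          of "w k i j" "\<omega> k i j" "\<mu> (Suc k) i j"]
        primitive_has_real_derivative[OF cont(1)[of "gridpt N i j"] pos[OF that, of i j],
          of "\<mu> (Suc k) i j"]]
    by (simp add: algebra_simps)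
  have "((\<lambda>t. cost (mt t) (wt t)) has_real_derivative ?D) (at 0)"
    unfolding cost_def gsum_def mt_def wt_def
    by (rule DERIV_add, (rule DERIV_sum)+, rule stage, simp, rule DERIV_cmult, (rule DERIV_sum)+,
        rule primitive_has_real_derivative[OF cont(2) pos_NT])
  then obtain d where d: "d > 0" "\<And>t. 0 < t \<Longrightarrow> t < d \<Longrightarrow> cost (mt t) (wt t) < cost (mt 0) (wt 0)"
    using DERIV_neg_dec_right[of "\<lambda>t. cost (mt t) (wt t)" ?D 0] neg by auto
  have "\<forall>\<^sub>F t in at_right 0. \<forall>p\<in>{..<NT} \<times> {0..<int N} \<times> {0..<int N}.
      case p of (k, i, j) \<Rightarrow> mt t (Suc k) i j > 0"
  \<comment> \<open>By periodicity only finitely many positivity conditions matter, so one small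
    \<open>t\<close> satisfies all of them.\<close>
  proof (intro eventually_ball_finite ballI)
    fix p assume "p \<in> {..<NT} \<times> {0..<int N} \<times> {0..<int N}"
    then obtain k i j where p: "p = (k, i, j)" and k: "k < NT" by auto
    have "((\<lambda>t. mt t (Suc k) i j) \<longlongrightarrow> m (Suc k) i j + 0 * \<mu> (Suc k) i j) (at_right 0)"
      unfolding mt_def by (intro tendsto_intros)
    then have "\<forall>\<^sub>F t in at_right 0. mt t (Suc k) i j > 0"
      using pos[OF k, of i j] by (intro order_tendstoD) auto
    then show "\<forall>\<^sub>F t in at_right 0. case p of (k, i, j) \<Rightarrow> mt t (Suc k) i j > 0"
      by (simp add: p)
  qed auto
  moreover have "\<forall>\<^sub>F t in at_right (0::real). t \<in> {0<..<min d 1}"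
    using d(1) by (intro eventually_at_right_real) auto
  ultimately have "\<forall>\<^sub>F t in at_right (0::real). (\<forall>p\<in>{..<NT} \<times> {0..<int N} \<times> {0..<int N}.
      case p of (k, i, j) \<Rightarrow> mt t (Suc k) i j > 0) \<and> t \<in> {0<..<min d 1}"
    by (rule eventually_conj)
  from eventually_happens'[OF trivial_limit_at_right_real this]
  show False
  proof (elim exE conjE)
    fix t assume elim: "\<forall>p\<in>{..<NT} \<times> {0..<int N} \<times> {0..<int N}.
      case p of (k, i, j) \<Rightarrow> mt t (Suc k) i j > 0" "t \<in> {0<..<min d 1}"
    have grid: "mt t k \<in> gridfun N" if "k \<le> NT" for k
      unfolding mt_def using dynamicsD(1)[OF dyn that] \<mu>(1)[of k] by (rule gridfun_comp2)
    have gridw: "wt t k \<in> gridfun N" if "k < NT" for k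
      unfolding wt_def using dynamicsD(3)[OF dyn that] \<omega>(1)[of k] by (rule gridfun_comp2)
    have "opA \<nu> T NT N (mt t) k i j + opB N (wt t) k i j = 0" if "k < NT" for k i j
    proof -
      have "opA \<nu> T NT N (mt t) k i j + opB N (wt t) k i j =
        (opA \<nu> T NT N m k i j + opB N w k i j) + t * (opA \<nu> T NT N \<mu> k i j + opB N \<omega> k i j)"
        unfolding mt_def wt_def opA_perturb opB_perturb by (simp add: algebra_simps)
      then show ?thesis using lin[OF that] dynamicsD(5)[OF dyn that] by simp
    qed
    moreover have "mt t 0 = mb"
      using dynamicsD(4)[OF dyn] \<mu>(2) by (simp add: mt_def)
    ultimately have dyn_t: "dynamics (mt t) (wt t)"
      using grid gridw by (simp add: dynamics_def)
    have pos_t: "mt t (Suc k) i j > 0" if "k < NT" for k i j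
    proof (rule gridfun_everywhere[where P = "\<lambda>i j. mt t (Suc k) i j > 0", OF _ N])
      show "(\<lambda>i j. mt t (Suc k) i j > 0) \<in> gridfun N"
        using grid[of "Suc k"] that by (intro gridfun_comp[where F = "\<lambda>x. x > 0"]) simp
    qed (use elim(1) that in auto)
    have cone_t: "wt t k i j \<in> coneK" if "k < NT" for k i j
    proof -
      have "w k i j \<in> coneK" using ctl that by (simp add: controlled_def)
      \<comment> \<open>The varied flux is a convex combination of two elements of the cone.\<close>
      moreover have "wt t k i j $ a = (1 - t) * (w k i j $ a) + t * ((w k i j + \<omega> k i j) $ a)" for a
        by (simp add: wt_def algebra_simps)
      ultimately show ?thesis
        using \<omega>(2)[OF that, of i j] elim(2)
        by (simp add: coneK_def mult_nonneg_nonpos add_nonneg_nonneg add_nonpos_nonpos del: vector_add_component)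
    qed
    have "controlled (mt t) (wt t)"
      unfolding controlled_def using pos_t cone_t by (simp add: less_imp_le less_imp_neq[symmetric])
    then have "cost m w \<le> cost (mt t) (wt t)" by (rule min[OF dyn_t])
    moreover have "mt 0 = m" "wt 0 = w" by (simp_all add: mt_def wt_def)
    ultimately show False using d(2)[of t] elim(2) by simp
  qed
qed

text \<open>Summation by parts in time and the Green formula in space. The boundary term at time 0
  vanishes with \<open>\<mu> 0\<close>, and the one at \<open>NT\<close> is the terminal term with
  weight \<open>1 / tstep T NT\<close>.\<close>

lemma adjoint_pairing:
  assumes u: "\<And>k. u k \<in> gridfun N" and \<mu>: "\<And>k. \<mu> k \<in> gridfun N" "\<mu> 0 = (\<lambda>i j. 0)"
    and adj: "\<And>k i j. k < NT \<Longrightarrow> - Dt T NT u k i j - \<nu> * Lap N (u k) i j = s k i j"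
  shows "(\<Sum>k<NT. gsum N (\<lambda>i j. s k i j * \<mu> (Suc k) i j))
      + 1 / tstep T NT * gsum N (\<lambda>i j. u NT i j * \<mu> NT i j)
    = (\<Sum>k<NT. gsum N (\<lambda>i j. u k i j * opA \<nu> T NT N \<mu> k i j))"
proof -
  define p where "p k = gsum N (\<lambda>i j. u k i j * \<mu> k i j) / tstep T NT" for k
  have "gsum N (\<lambda>i j. s k i j * \<mu> (Suc k) i j) =
      gsum N (\<lambda>i j. u k i j * opA \<nu> T NT N \<mu> k i j) + (p k - p (Suc k))" if "k < NT" for k
  proof -
    have "gsum N (\<lambda>i j. s k i j * \<mu> (Suc k) i j) =
      gsum N (\<lambda>i j. u k i j * \<mu> (Suc k) i j) / tstep T NT - p (Suc k)
      - \<nu> * gsum N (\<lambda>i j. Lap N (u k) i j * \<mu> (Suc k) i j)"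
      unfolding p_def gsum_divide[symmetric] gsum_cmult[symmetric] gsum_diff[symmetric]
      by (rule gsum_cong)
        (simp add: adj[OF that, symmetric] Dt_def algebra_simps diff_divide_distrib add_divide_distrib)
    moreover have "gsum N (\<lambda>i j. u k i j * opA \<nu> T NT N \<mu> k i j) =
      gsum N (\<lambda>i j. u k i j * \<mu> (Suc k) i j) / tstep T NT - p k
      - \<nu> * gsum N (\<lambda>i j. u k i j * Lap N (\<mu> (Suc k)) i j)"
      unfolding p_def gsum_divide[symmetric] gsum_cmult[symmetric] gsum_diff[symmetric]
      by (rule gsum_cong)
        (simp add: opA_def Dt_def algebra_simps diff_divide_distrib add_divide_distrib)
    ultimately show ?thesis
      using gsum_Lap_symmetric[OF u \<mu>(1), of k "Suc k"] by simp
  qed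
  then have "(\<Sum>k<NT. gsum N (\<lambda>i j. s k i j * \<mu> (Suc k) i j)) =
    (\<Sum>k<NT. gsum N (\<lambda>i j. u k i j * opA \<nu> T NT N \<mu> k i j)) + (p 0 - p NT)"
    by (simp add: sum.distrib sum_lessThan_telescope')
  moreover have "p 0 = 0" by (simp add: p_def \<mu>(2) gsum_def)
  ultimately show ?thesis by (simp add: p_def)
qed

text \<open>The adjoint equation rewrites the density part of the first variation as the pairing of
  \<open>u\<close> with \<open>opA\<close> of \<open>\<mu>\<close>, that is, with
  \<open>- opB\<close> of \<open>\<omega>\<close>. Transposing \<open>opB\<close> eliminates
  \<open>\<mu>\<close>, and the localised \<open>\<omega>\<close> leaves one grid point.\<close>

lemma flux_variation:
  assumes dyn: "dynamics m w" and ctl: "controlled m w"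
    and min: "\<And>m' w'. dynamics m' w' \<Longrightarrow> controlled m' w' \<Longrightarrow> cost m w \<le> cost m' w'"
    and u: "\<And>k. u k \<in> gridfun N"
    and adj: "\<And>k i j. k < NT \<Longrightarrow> - Dt T NT u k i j - \<nu> * Lap N (u k) i j =
      f (gridpt N i j) (m (Suc k) i j) - (q - 1) / q * (norm (w k i j) powr q / m (Suc k) i j powr q)"
    and u_NT: "\<And>i j. u NT i j = g (gridpt N i j) (m NT i j)"
    and k0: "k0 < NT" and i0: "i0 \<in> {0..<int N}" and j0: "j0 \<in> {0..<int N}" and \<kappa>: "\<kappa> \<in> coneK"
  shows "((norm (w k0 i0 j0) powr (q - 2) / m (Suc k0) i0 j0 powr (q - 1)) *\<^sub>R w k0 i0 j0
     - adjB N (u k0) i0 j0) \<bullet> (\<kappa> - w k0 i0 j0) \<ge> 0"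
proof -
  define l where "l k i j = norm (w k i j) powr (q - 2) / m (Suc k) i j powr (q - 1)" for k i j
  \<comment> \<open>Replaces the flux by \<open>\<kappa>\<close> at all periodic copies of one
    point, which keeps it a grid function.\<close>
  define \<omega> where "\<omega> k i j = (if k = k0 \<and> i mod int N = i0 \<and> j mod int N = j0
    then \<kappa> - w k0 i0 j0 else 0)" for k i j
  define \<mu> where "\<mu> = heat_flow N \<nu> (tstep T NT) (\<lambda>k i j. - opB N \<omega> k i j) (\<lambda>i j. 0)"
  have \<omega>_grid: "\<omega> k \<in> gridfun N" for k by (simp add: gridfun_def \<omega>_def)
  have src: "(\<lambda>i j. - opB N \<omega> k i j) \<in> gridfun N" for k
    by (rule gridfun_comp[OF gridfun_opB[OF \<omega>_grid]])
  have \<mu>_grid: "\<mu> k \<in> gridfun N" for k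
    unfolding \<mu>_def by (rule gridfun_heat_flow[OF gridfun_const src])
  have \<mu>_0: "\<mu> 0 = (\<lambda>i j. 0)" by (simp add: \<mu>_def)
  have A\<mu>: "opA \<nu> T NT N \<mu> k i j = - opB N \<omega> k i j" for k i j
    using heat_flow_eq[where \<nu> = \<nu> and \<tau> = "tstep T NT" and k = k and i = i and j = j,
        OF gridfun_const[of 0] src N] nu tstep_pos
    by (simp add: opA_def Dt_def \<mu>_def del: heat_flow.simps)
  have cone: "w k i j + \<omega> k i j \<in> coneK" if "k < NT" for k i j
  proof (cases "k = k0 \<and> i mod int N = i0 \<and> j mod int N = j0")
    case True
    then have "w k i j = w k0 i0 j0"
      using gridfun_mod[OF dynamicsD(3)[OF dyn k0], of i j] by simp
    then show ?thesis using True \<kappa> by (simp add: \<omega>_def)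
  next
    case False
    then have "\<omega> k i j = 0" by (auto simp: \<omega>_def)
    then show ?thesis using ctl that by (simp add: controlled_def)
  qed
  have pairing: "(\<Sum>k<NT. gsum N (\<lambda>i j. (f (gridpt N i j) (m (Suc k) i j)
         - (q - 1) / q * (norm (w k i j) powr q / m (Suc k) i j powr q)) * \<mu> (Suc k) i j))
      + 1 / tstep T NT * gsum N (\<lambda>i j. u NT i j * \<mu> NT i j)
    = (\<Sum>k<NT. gsum N (\<lambda>i j. u k i j * opA \<nu> T NT N \<mu> k i j))"
    by (rule adjoint_pairing[where u = u and \<mu> = \<mu>, OF u \<mu>_grid \<mu>_0]) (rule adj)
  have "0 \<le> (\<Sum>k<NT. gsum N (\<lambda>i j. l k i j * (w k i j \<bullet> \<omega> k i j)
      + (f (gridpt N i j) (m (Suc k) i j)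
         - (q - 1) / q * (norm (w k i j) powr q / m (Suc k) i j powr q)) * \<mu> (Suc k) i j))
    + 1 / tstep T NT * gsum N (\<lambda>i j. g (gridpt N i j) (m NT i j) * \<mu> NT i j)"
    unfolding l_def
    by (rule first_variation[where m = m and w = w and \<mu> = \<mu> and \<omega> = \<omega>,
          OF dyn ctl min \<mu>_grid \<mu>_0 \<omega>_grid cone]) (simp_all add: A\<mu>)
  also have "\<dots> = (\<Sum>k<NT. gsum N (\<lambda>i j. l k i j * (w k i j \<bullet> \<omega> k i j)))
      + (\<Sum>k<NT. gsum N (\<lambda>i j. u k i j * opA \<nu> T NT N \<mu> k i j))"
    unfolding pairing[symmetric]
    by (simp add: gsum_add sum.distrib u_NT)
  also have "\<dots> = (\<Sum>k<NT. gsum N (\<lambda>i j. (l k i j *\<^sub>R w k i j - adjB N (u k) i j) \<bullet> \<omega> k i j))"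
  proof -
    have "gsum N (\<lambda>i j. u k i j * opA \<nu> T NT N \<mu> k i j) =
        - gsum N (\<lambda>i j. adjB N (u k) i j \<bullet> \<omega> k i j)" for k
      using gsum_opB_adjoint[where y = "u k" and w = \<omega> and k = k, OF u \<omega>_grid] by (simp add: A\<mu> gsum_def sum_negf)
    then show ?thesis
      by (simp add: inner_diff_left gsum_diff sum_subtractf sum_negf)
  qed
  also have "\<dots> = (\<Sum>k\<in>{k0}. gsum N (\<lambda>i j. (l k i j *\<^sub>R w k i j - adjB N (u k) i j) \<bullet> \<omega> k i j))"
    using k0 by (intro sum.mono_neutral_right) (auto simp: \<omega>_def gsum_def)
  also have "\<dots> = (l k0 i0 j0 *\<^sub>R w k0 i0 j0 - adjB N (u k0) i0 j0) \<bullet> \<omega> k0 i0 j0"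
  proof -
    have "gsum N (\<lambda>i j. (l k0 i j *\<^sub>R w k0 i j - adjB N (u k0) i j) \<bullet> \<omega> k0 i j) =
      (l k0 i0 j0 *\<^sub>R w k0 i0 j0 - adjB N (u k0) i0 j0) \<bullet> \<omega> k0 i0 j0"
      by (rule gsum_single[OF i0 j0]) (auto simp: \<omega>_def)
    then show ?thesis by simp
  qed
  also have "\<omega> k0 i0 j0 = \<kappa> - w k0 i0 j0" using i0 j0 by (simp add: \<omega>_def)
  finally show ?thesis by (simp add: l_def)
qed

text \<open>The negative part of \<open>a\<close> is the positive part of \<open>- a\<close>. Thus
  \<open>hatD\<close> is the projection of \<open>adjB\<close> onto \<open>coneK\<close>, in the
  form delivered by \<open>coneK_projection\<close>.\<close>

lemma hatD_adjB:
  "hatD N y i j = vector [max (adjB N y i j $ 1) 0, min (adjB N y i j $ 2) 0,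
     max (adjB N y i j $ 3) 0, min (adjB N y i j $ 4) 0]"
  by (simp add: hatD_def adjB_def negpart_def pospart_def max_def min_def)

text \<open>Inverts the Legendre relation \<open>p = |w|^(q - 2) w / m^(q - 1)\<close>: taking norms
  gives \<open>|p| = (|w| / m)^(q - 1)\<close>, hence
  \<open>w = m |p|^((2 - q) / (q - 1)) p\<close>. Where \<open>w = 0\<close>, both sides
  vanish.\<close>

lemma mfg_of_hatD:
  assumes dyn: "dynamics m w" and ctl: "controlled m w" and k: "k < NT"
    and H: "\<And>i j. hatD N v i j = (norm (w k i j) powr (q - 2) / m (Suc k) i j powr (q - 1)) *\<^sub>R w k i j"
  shows "norm (hatD N v i j) powr (q / (q - 1)) = norm (w k i j) powr q / m (Suc k) i j powr q"
    and "transport q N v (m (Suc k)) i j = - opB N w k i j"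
proof -
  have pos: "m (Suc k) i j > 0" for i j by (rule dynamics_positive[OF dyn ctl k])
  have n: "norm (hatD N v i j) = (norm (w k i j) / m (Suc k) i j) powr (q - 1)" for i j
  proof (cases "w k i j = 0")
    case False
    have "norm (w k i j) powr (q - 2) * norm (w k i j) = norm (w k i j) powr (q - 1)"
      using powr_mult_base[of "norm (w k i j)" "q - 2"] by (simp add: mult.commute)
    then show ?thesis
      using pos[of i j] by (simp add: H powr_divide)
  qed (simp add: H)
  show "norm (hatD N v i j) powr (q / (q - 1)) = norm (w k i j) powr q / m (Suc k) i j powr q"
    unfolding n using q pos[of i j] by (simp add: powr_powr powr_divide)
  have flux: "w k i j = (m (Suc k) i j * coef q N v i j) *\<^sub>R hatD N v i j" for i j
  proof (cases "w k i j = 0")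
    case False
    have "coef q N v i j = (norm (w k i j) / m (Suc k) i j) powr (2 - q)"
      unfolding coef_def n using q by (simp add: powr_powr)
    also have "\<dots> = norm (w k i j) powr (2 - q) / m (Suc k) i j powr (2 - q)"
      using pos[of i j] by (simp add: powr_divide)
    finally have "m (Suc k) i j * coef q N v i j * (norm (w k i j) powr (q - 2) / m (Suc k) i j powr (q - 1))
       = (norm (w k i j) powr (2 - q) * norm (w k i j) powr (q - 2))
         * (m (Suc k) i j / (m (Suc k) i j powr (2 - q) * m (Suc k) i j powr (q - 1)))"
      by simp
    also have "\<dots> = 1"
      using False pos[of i j] by (simp flip: powr_add)
    finally have one: "m (Suc k) i j * coef q N v i j
      * (norm (w k i j) powr (q - 2) / m (Suc k) i j powr (q - 1)) = 1" .
    show ?thesis by (simp only: H scaleR_scaleR one scaleR_one)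
  qed (simp add: H)
  \<comment> \<open>Componentwise, these are the products in \<open>transport\<close>, whose eight
    summands are those of \<open>opB\<close> with opposite sign.\<close>
  have c: "w k i j $ 1 = m (Suc k) i j * coef q N v i j * negpart (D1 N v i j)"
    "w k i j $ 2 = - m (Suc k) i j * coef q N v i j * pospart (D1 N v (i - 1) j)"
    "w k i j $ 3 = m (Suc k) i j * coef q N v i j * negpart (D2 N v i j)"
    "w k i j $ 4 = - m (Suc k) i j * coef q N v i j * pospart (D2 N v i (j - 1))" for i j
    using arg_cong[OF flux[of i j], of "\<lambda>x. x $ 1"] arg_cong[OF flux[of i j], of "\<lambda>x. x $ 2"]
      arg_cong[OF flux[of i j], of "\<lambda>x. x $ 3"] arg_cong[OF flux[of i j], of "\<lambda>x. x $ 4"]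
    by (simp_all add: hatD_def)
  show "transport q N v (m (Suc k)) i j = - opB N w k i j"
  proof -
    have "opB N w k i j = (w k i j $ 1 - w k (i - 1) j $ 1 + w k (i + 1) j $ 2 - w k i j $ 2
        + w k i j $ 3 - w k i (j - 1) $ 3 + w k i (j + 1) $ 4 - w k i j $ 4) / mesh N"
      by (simp add: opB_def D1_def D2_def add_divide_distrib diff_divide_distrib)
    then show ?thesis
      using mesh_pos by (simp add: transport_def c field_simps)
  qed
qed

lemma solution_mfg_system:
  assumes sol: "is_solution q \<nu> T NT N f g mb m w"
  shows "\<exists>u \<in> spaceM NT N. mfg_system q \<nu> T NT N f g mb u m"
proof -
  note dyn = solution_minimal(1)[OF sol] and ctl = solution_minimal(2)[OF sol]
    and min = solution_minimal(3)[OF sol]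
  define s where "s k i j = f (gridpt N i j) (m (Suc k) i j)
    - (q - 1) / q * (norm (w k i j) powr q / m (Suc k) i j powr q)" for k i j
  \<comment> \<open>Time reversal: \<open>v l\<close> is \<open>u\<close> at time
    \<open>NT - l\<close>, so the step from \<open>l\<close> to \<open>Suc l\<close> uses the source
    at time \<open>NT - 1 - l\<close>.\<close>
  define v where "v = heat_flow N \<nu> (tstep T NT) (\<lambda>l. s (NT - 1 - l))
    (\<lambda>i j. g (gridpt N i j) (m NT i j))"
  define u where "u k = v (NT - k)" for k
  have g_grid: "(\<lambda>i j. g (gridpt N i j) (m NT i j)) \<in> gridfun N"
    using gridpt_periodic[OF g_periodic N] dynamicsD(1)[OF dyn, of NT] by (simp add: gridfun_def)
  have s_grid: "s (NT - 1 - l) \<in> gridfun N" for l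
  proof -
    \<comment> \<open>Truncated subtraction keeps the index admissible for every \<open>l\<close>,
      as \<open>heat_flow\<close> asks for grid functions at all times.\<close>
    have "NT - 1 - l < NT" using NT by simp
    then show ?thesis
      using gridpt_periodic[OF f_periodic N] dynamicsD(2,3)[OF dyn, of "NT - 1 - l"]
      by (simp add: gridfun_def s_def)
  qed
  have u_grid: "u k \<in> gridfun N" for k
    unfolding u_def v_def by (rule gridfun_heat_flow[OF g_grid s_grid])
  have u_NT: "u NT i j = g (gridpt N i j) (m NT i j)" for i j
    by (simp add: u_def v_def)
  have adj: "- Dt T NT u k i j - \<nu> * Lap N (u k) i j = s k i j" if "k < NT" for k i j
  proof -
    have e: "NT - k = Suc (NT - Suc k)" "NT - 1 - (NT - Suc k) = k" using that by auto
    have "(v (NT - k) i j - v (NT - Suc k) i j) / tstep T NT - \<nu> * Lap N (v (NT - k)) i j = s k i j"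
      using heat_flow_eq[where \<nu> = \<nu> and \<tau> = "tstep T NT" and k = "NT - Suc k" and i = i and j = j
          and s = "\<lambda>l. s (NT - 1 - l)", OF g_grid s_grid N] nu tstep_pos
      unfolding e(1) v_def[symmetric] e(2) by simp
    then show ?thesis by (simp add: Dt_def u_def minus_divide_left)
  qed
  have H: "hatD N (u k) i j = (norm (w k i j) powr (q - 2) / m (Suc k) i j powr (q - 1)) *\<^sub>R w k i j"
    if k: "k < NT" for k i j
  proof (rule gridfun_everywhere[where P = "\<lambda>i j. hatD N (u k) i j =
      (norm (w k i j) powr (q - 2) / m (Suc k) i j powr (q - 1)) *\<^sub>R w k i j", OF _ N])
    show "(\<lambda>i j. hatD N (u k) i j =
      (norm (w k i j) powr (q - 2) / m (Suc k) i j powr (q - 1)) *\<^sub>R w k i j) \<in> gridfun N"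
      using gridfun_hatD[OF u_grid[of k]] dynamicsD(2,3)[OF dyn k] by (simp add: gridfun_def)
    fix i j assume ij: "i \<in> {0..<int N}" "j \<in> {0..<int N}"
    show "hatD N (u k) i j = (norm (w k i j) powr (q - 2) / m (Suc k) i j powr (q - 1)) *\<^sub>R w k i j"
      unfolding hatD_adjB
    proof (rule coneK_projection[symmetric])
      show "w k i j \<in> coneK" using ctl k by (simp add: controlled_def)
    next
      fix \<kappa> :: "real ^ 4" assume "\<kappa> \<in> coneK"
      then show "0 \<le> ((norm (w k i j) powr (q - 2) / m (Suc k) i j powr (q - 1)) *\<^sub>R w k i j
          - adjB N (u k) i j) \<bullet> (\<kappa> - w k i j)"
        using flux_variation[where m = m and w = w and u = u, OF dyn ctl _ u_grid _ u_NT k ij]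
          min adj unfolding s_def by blast
    qed simp
  qed
  have mfg: "mfg_system q \<nu> T NT N f g mb u m"
    unfolding mfg_system_def
  proof (intro ballI conjI)
    fix i j k assume "k \<in> {0..<NT}"
    then have k: "k < NT" by simp
    \<comment> \<open>The Hamiltonian added on the left cancels the kinetic term that
      \<open>s\<close> contains.\<close>
    show "- Dt T NT u k i j - \<nu> * Lap N (u k) i j
        + 1 / (q / (q - 1)) * norm (hatD N (u k) i j) powr (q / (q - 1))
        = f (gridpt N i j) (m (k + 1) i j)"
      unfolding adj[OF k] mfg_of_hatD(1)[OF dyn ctl k H[OF k]] by (simp add: s_def)
    show "Dt T NT m k i j - \<nu> * Lap N (m (k + 1)) i j - transport q N (u k) (m (k + 1)) i j = 0"
      using mfg_of_hatD(2)[OF dyn ctl k H[OF k], of i j] dynamicsD(5)[OF dyn k, of i j]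
      by (simp add: opA_def)
  next
    fix i j show "m 0 i j = mb i j" using dynamicsD(4)[OF dyn] by simp
  qed (rule u_NT)
  have "mfg_system q \<nu> T NT N f g mb (restrict u {0..NT}) m"
    using mfg by (simp add: mfg_system_def Dt_def)
  moreover have "restrict u {0..NT} \<in> spaceM NT N"
    using u_grid by (auto simp: spaceM_def)
  ultimately show ?thesis by blast
qed

lemma solution_positive:
  assumes sol: "is_solution q \<nu> T NT N f g mb m w" and "k \<in> {1..NT}"
  shows "m k i j > 0"
proof -
  have "k - 1 < NT" "Suc (k - 1) = k" using assms(2) by auto
  then show ?thesis
    using dynamics_positive[OF solution_minimal(1,2)[OF sol], of "k - 1" i j] by simp
qed

end

subsection \<open>Averages of the initial density\<close>

lemma torus_periodic_of_int:
  assumes "torus_periodic \<phi>"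
  shows "\<phi> (x + of_int a, y + of_int b) = \<phi> (x, y)"
proof -
  have p: "\<phi> (x + 1, y) = \<phi> (x, y)" "\<phi> (x, y + 1) = \<phi> (x, y)" for x y
    using assms by (auto simp: torus_periodic_def)
  have 1: "\<phi> (x + of_int a, y) = \<phi> (x, y)" for x y a
  proof (induction a rule: int_induct[where k = 0])
    case (step1 a)
    then show ?case using p(1)[of "x + of_int a" y] by (simp add: algebra_simps)
  next
    case (step2 a)
    then show ?case using p(1)[of "x + of_int (a - 1)" y] by (simp add: algebra_simps)
  qed simp
  have 2: "\<phi> (x, y + of_int b) = \<phi> (x, y)" for x y b
  proof (induction b rule: int_induct[where k = 0])
    case (step1 b)
    then show ?case using p(2)[of x "y + of_int b"] by (simp add: algebra_simps)
  next
    case (step2 b)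
    then show ?case using p(2)[of x "y + of_int (b - 1)"] by (simp add: algebra_simps)
  qed simp
  show ?thesis by (simp add: 1 2)
qed

definition cell :: "nat \<Rightarrow> int \<Rightarrow> int \<Rightarrow> (real \<times> real) set" where
  "cell N i j = cbox (gridpt N i j - (mesh N / 2, mesh N / 2)) (gridpt N i j + (mesh N / 2, mesh N / 2))"

lemma mbar_cell: "mbar N m0 i j = 1 / (mesh N)\<^sup>2 * integral (cell N i j) m0"
  by (simp add: mbar_def cell_def)

text \<open>Shifting an index by \<open>N\<close> translates the cell by one period, which leaves
  the integral of a periodic function unchanged.\<close>

lemma gridfun_mbar:
  assumes per: "torus_periodic m0" and N: "N > 0"
  shows "mbar N m0 \<in> gridfun N"
proof -
  have shift: "integral (cbox (a - (of_int k, of_int l)) (b - (of_int k, of_int l))) m0 = integral (cbox a b) m0"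
    for a b k l
  proof -
    have "(\<lambda>x. m0 (x + (of_int k, of_int l))) = m0"
      using torus_periodic_of_int[OF per] by (auto simp: fun_eq_iff)
    then show ?thesis
      using integral_shift_cbox[of a "(of_int k, of_int l)" b m0] by simp
  qed
  have g: "gridpt N (i + int N) j = gridpt N i j - (of_int (- 1), of_int 0)"
    "gridpt N i (j + int N) = gridpt N i j - (of_int 0, of_int (- 1))" for i j
    using N by (simp_all add: gridpt_def mesh_def add_divide_distrib)
  have "integral (cell N (i + int N) j) m0 = integral (cell N i j) m0"
    "integral (cell N i (j + int N)) m0 = integral (cell N i j) m0" for i j
    unfolding cell_def g
    using shift[of "gridpt N i j - (mesh N / 2, mesh N / 2)" "- 1" 0 "gridpt N i j + (mesh N / 2, mesh N / 2)"]
      shift[of "gridpt N i j - (mesh N / 2, mesh N / 2)" 0 "- 1" "gridpt N i j + (mesh N / 2, mesh N / 2)"]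
    by (simp_all add: algebra_simps)
  then show ?thesis by (simp add: gridfun_def mbar_cell)
qed

lemma mbar_nonneg:
  assumes "AE x in lebesgue. m0 x \<ge> 0"
  shows "mbar N m0 i j \<ge> 0"
proof -
  have "negligible {x. \<not> m0 x \<ge> 0}"
    using assms by (simp add: negligible_iff_null_sets AE_iff_null_sets[symmetric] completion.AE_iff_null_sets)
  then have "integral (cell N i j) m0 = integral (cell N i j) (\<lambda>x. max 0 (m0 x))"
    by (rule integral_spike) auto
  \<comment> \<open>Without integrability the integral takes its default value 0, again
    nonnegative.\<close>
  moreover have "integral (cell N i j) (\<lambda>x. max 0 (m0 x)) \<ge> 0"
    by (cases "(\<lambda>x. max 0 (m0 x)) integrable_on cell N i j")
      (auto simp: not_integrable_integral intro!: integral_nonneg)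
  ultimately show ?thesis by (simp add: mbar_cell)
qed

text \<open>Cells with an index 0 or \<open>N\<close> overlap the edge of the unit square. Nine
  integer translates of the square cover every such cell, and periodicity carries the integrability
  of \<open>m0\<close> and of its norm to each translate.\<close>

lemma integrable_on_cell:
  fixes m0 :: "real \<times> real \<Rightarrow> real"
  assumes per: "torus_periodic m0" and int: "m0 absolutely_integrable_on cbox (0, 0) (1, 1)"
    and N: "N > 0" and ij: "i \<in> {0..int N}" "j \<in> {0..int N}"
  shows "m0 absolutely_integrable_on cell N i j"
proof -
  let ?Q = "\<lambda>a b. cbox (of_int a, of_int b) (of_int a + 1, of_int b + 1) :: (real \<times> real) set"
  have shift: "f integrable_on ?Q a b" if "f integrable_on cbox (0, 0) (1, 1)" "torus_periodic f"
    for f :: "real \<times> real \<Rightarrow> real" and a b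
  proof -
    have "(\<lambda>x. f (x + (of_int (- a), of_int (- b)))) = f"
      using torus_periodic_of_int[OF that(2), of _ "- a" _ "- b"] by (auto simp: fun_eq_iff)
    then show ?thesis
      using integrable_shift_cbox[OF that(1), of "(of_int (- a), of_int (- b))"]
      by (simp add: add.commute)
  qed
  have "m0 absolutely_integrable_on ?Q a b" for a b
    using int shift[of m0 a b] shift[of "\<lambda>x. norm (m0 x)" a b] per
    by (simp add: absolutely_integrable_on_def torus_periodic_def)
  then have "m0 absolutely_integrable_on (\<Union>p\<in>{-1..1} \<times> {-1..1}. ?Q (fst p) (snd p))"
    by (intro set_integrable_UN) auto
  moreover have "cell N i j \<in> sets lebesgue"
    by (simp add: cell_def)
  moreover have "cell N i j \<subseteq> (\<Union>p\<in>{-1..1} \<times> {-1..1}. ?Q (fst p) (snd p))"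
  proof clarify
    fix x y assume xy: "(x, y) \<in> cell N i j"
    have b: "of_int i * mesh N \<in> {0..1}" if "i \<in> {0..int N}" for i
      using that N by (auto simp: mesh_def field_simps)
    have h: "mesh N \<le> 1" using N by (simp add: mesh_def)
    have "- 1 \<le> x \<and> x \<le> 2 \<and> - 1 \<le> y \<and> y \<le> 2"
      using xy b[OF ij(1)] b[OF ij(2)] h by (simp add: cell_def gridpt_def cbox_Pair_eq)
    moreover have "\<exists>a\<in>{-1..1::int}. of_int a \<le> z \<and> z \<le> of_int a + 1" if "- 1 \<le> z \<and> z \<le> 2" for z :: real
    proof -
      consider "z \<le> 0" | "0 \<le> z" "z \<le> 1" | "1 \<le> z" by linarith
      then show ?thesis
        using that by cases (auto intro: bexI[of _ "-1"] bexI[of _ 0] bexI[of _ 1])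
    qed
    ultimately show "(x, y) \<in> (\<Union>p\<in>{-1..1} \<times> {-1..1}. ?Q (fst p) (snd p))"
      by (simp add: cbox_Pair_eq)
  qed
  ultimately show ?thesis
    by (rule set_integrable_subset)
qed

text \<open>If every average vanished, the nonnegative \<open>m0\<close> would vanish almost
  everywhere on each of the finitely many cells covering the unit square, contradicting its positive
  integral.\<close>

lemma mbar_pos:
  assumes per: "torus_periodic m0" and int: "m0 absolutely_integrable_on cbox (0, 0) (1, 1)"
    and ae: "AE x in lebesgue. m0 x \<ge> 0" and pos: "integral (cbox (0, 0) (1, 1)) m0 > 0"
    and N: "N > 0"
  shows "\<exists>i j. mbar N m0 i j > 0"
proof (rule ccontr)
  assume "\<nexists>i j. mbar N m0 i j > 0"
  then have "mbar N m0 i j = 0" for i j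
    using mbar_nonneg[OF ae, of N i j] by (metis order_le_less)
  moreover have h: "mesh N > 0" using N by (simp add: mesh_def)
  ultimately have z: "integral (cell N i j) m0 = 0" for i j
    using mbar_cell[of N m0 i j] by simp
  have "AE x in lebesgue. x \<in> cell N i j \<longrightarrow> m0 x = 0" if ij: "i \<in> {0..int N}" "j \<in> {0..int N}" for i j
  proof -
    note ai = integrable_on_cell[OF per int N ij]
    have "integral\<^sup>L lebesgue (\<lambda>x. indicat_real (cell N i j) x *\<^sub>R m0 x) = 0"
      using set_lebesgue_integral_eq_integral(2)[OF ai] z by (simp add: set_lebesgue_integral_def)
    moreover have "AE x in lebesgue. 0 \<le> indicat_real (cell N i j) x *\<^sub>R m0 x"
      using ae by eventually_elim simp
    ultimately have "AE x in lebesgue. indicat_real (cell N i j) x *\<^sub>R m0 x = 0"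
      using integral_nonneg_eq_0_iff_AE ai unfolding set_integrable_def by blast
    then show ?thesis by eventually_elim auto
  qed
  then have "AE x in lebesgue. \<forall>p\<in>{0..int N} \<times> {0..int N}. x \<in> cell N (fst p) (snd p) \<longrightarrow> m0 x = 0"
    by (intro eventually_ball_finite) auto
  then have "AE x in lebesgue. indicat_real (cbox (0, 0) (1, 1)) x *\<^sub>R m0 x = 0"
  proof eventually_elim
    case (elim x)
    show ?case
    proof (cases "x \<in> cbox (0, 0) (1, 1)")
      case True
      obtain a b where x: "x = (a, b)" by (cases x)
      \<comment> \<open>Rounding selects the nearest grid line. The result may be \<open>N\<close>,
        for \<open>s\<close> near 1, which is why cells with index \<open>N\<close> are
        included.\<close>
      have r: "round (s * real N) \<in> {0..int N} \<and>
          \<bar>s - of_int (round (s * real N)) * mesh N\<bar> \<le> mesh N / 2" if "0 \<le> s" "s \<le> 1" for s :: real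
      proof -
        have le: "\<bar>of_int (round (s * real N)) - s * real N\<bar> \<le> 1 / 2"
          by (rule of_int_round_abs_le)
        have "0 \<le> s * real N" "s * real N \<le> real N"
          using that N by (auto simp: mult_left_le_one_le)
        then have "round (s * real N) \<ge> 0" "round (s * real N) \<le> int N"
          using le by linarith+
        moreover have "\<bar>s - of_int (round (s * real N)) * mesh N\<bar>
            = \<bar>of_int (round (s * real N)) - s * real N\<bar> * mesh N"
        proof -
          have "s - of_int (round (s * real N)) * mesh N = - (of_int (round (s * real N)) - s * real N) * mesh N"
            using N by (simp add: mesh_def field_simps)
          then show ?thesis using h by (simp add: abs_mult)
        qed
        moreover have "\<dots> \<le> 1 / 2 * mesh N"
          using le h by (intro mult_right_mono) auto
        ultimately show ?thesis by auto
      qed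
      have ab: "0 \<le> a" "a \<le> 1" "0 \<le> b" "b \<le> 1"
        using True by (auto simp: x cbox_Pair_eq)
      have "x \<in> cell N (round (a * real N)) (round (b * real N))"
        using r[OF ab(1,2)] r[OF ab(3,4)] unfolding abs_diff_le_iff
        by (simp add: x cell_def gridpt_def cbox_Pair_eq)
      then have "m0 x = 0"
        using elim r[OF ab(1,2)] r[OF ab(3,4)] by force
      then show ?thesis by simp
    qed simp
  qed
  then have "integral\<^sup>L lebesgue (\<lambda>x. indicat_real (cbox (0, 0) (1, 1)) x *\<^sub>R m0 x) = 0"
    by (rule integral_eq_zero_AE)
  then have "integral (cbox (0, 0) (1, 1)) m0 = 0"
    using set_lebesgue_integral_eq_integral(2)[OF int] by (simp add: set_lebesgue_integral_def)
  then show False using pos by simp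
qed

theorem theorem3p1:
  fixes q \<nu> T :: real
    and NT N :: nat
    and f g :: "real \<times> real \<Rightarrow> real \<Rightarrow> real"
    and m0 :: "real \<times> real \<Rightarrow> real"
  assumes "q > 1" and "T > 0" and "\<nu> > 0"
    and "NT > 0" and "N > 0"
    and "torus_periodic f" and "continuous_on UNIV (\<lambda>(x, s). f x s)"
    and "torus_periodic g" and "continuous_on UNIV (\<lambda>(x, s). g x s)"
    and "torus_periodic m0"
    and "m0 absolutely_integrable_on cbox (0, 0) (1, 1)"
    and "AE x in lebesgue. m0 x \<ge> 0"
    and "integral (cbox (0, 0) (1, 1)) m0 = 1"
  shows "(\<exists>m w. is_solution q \<nu> T NT N f g (mbar N m0) m w) \<and>
         (\<forall>m w. is_solution q \<nu> T NT N f g (mbar N m0) m w \<longrightarrow>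
            (\<exists>u \<in> spaceM NT N. mfg_system q \<nu> T NT N f g (mbar N m0) u m) \<and>
            (\<forall>k \<in> {1..NT}. \<forall>i \<in> {0..<int N}. \<forall>j \<in> {0..<int N}. m k i j > 0))"
proof -
  interpret discrete_mfg q \<nu> T NT N f g "mbar N m0"
    using assms mbar_pos[of m0 N] by unfold_locales (auto simp: gridfun_mbar mbar_nonneg)
  show ?thesis
    using solution_exists solution_mfg_system solution_positive by blast
qed

end
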